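(* Let $M,m,A,A_1,B,B_1>0$ and $\mu:=\frac{2M+m}{m}$, and assume $\mu>1+\frac{A}{4A_1}$, $\mu>1+\frac{B}{16B_1}$ and $(\mu-1)^{4/15}\left(\frac{4A_1}{A}\right)^{2/3}\neq\left(\frac{16B_1}{B}\right)^{2/5}$. Then for every angular momentum $C\in\mathbb R$ and every energy $h\in\mathbb R$, the set of initial conditions on the energy level $\{H_{\mathrm{red}}=h\}$ of the isosceles Schwarzschild problem whose solutions lead to triple collision has positive Lebesgue measure.
   Context: The isosceles Schwarzschild problem: two equal point masses $M$ move in a horizontal plane, symmetrically with respect to their midpoint $O$, and a third point mass $m$ moves on the vertical axis through $O$. Let $R>0$ be the distance between the equal masses and $z\in\mathbb R$ the signed height of $m$ above $O$. After reduction by rotations, with conserved angular momentum $C$, the motion is the Hamiltonian system on $\{(R,z,P_R,P_z):R>0\}$ with $$H_{\mathrm{red}}(R,z,P_R,P_z;C)=\frac1M\left(P_R^2+\frac{C^2}{R^2}\right)+\frac{2M+m}{4Mm}P_z^2-\frac{A}{R}-\frac{B}{R^3}-\frac{4A_1}{(R^2+4z^2)^{1/2}}-\frac{16B_1}{(R^2+4z^2)^{3/2}}.$$ For fixed $C$ and $h$ the energy level $\{H_{\mathrm{red}}=h\}$ is a hypersurface (3-dimensional), and Lebesgue measure on it means the induced 3-dimensional measure. A solution leads to triple collision if $(R,z)\to(0,0)$ as $t$ tends to the forward end of its maximal interval of existence. *)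

theory Defs
  imports "HOL-Analysis.Analysis"
begin

section \<open>Hausdorff measure\<close>

text \<open>
  With the factor \<open>unit_ball_vol n / 2 ^ n\<close>, the \<open>n\<close>-dimensional Hausdorff measure of a Euclidean
  space restricts on every embedded \<open>C\<^sup>1\<close> submanifold of dimension \<open>n\<close> to the Riemannian volume
  of the induced metric. A cover by countably many sets is indexed by \<open>nat\<close> and may be padded with
  empty sets, which must not contribute when \<open>n = 0\<close>. Boundedness is required because
  \<open>diameter\<close> is meaningless for unbounded sets.
\<close>

definition hausdorff_content :: "nat \<Rightarrow> 'a::metric_space set \<Rightarrow> ennreal" where
  "hausdorff_content n U =
     (if U = {} then 0 else ennreal (unit_ball_vol (real n) * (diameter U / 2) ^ n))"

definition hausdorff_pre :: "real \<Rightarrow> nat \<Rightarrow> 'a::metric_space set \<Rightarrow> ennreal" where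
  "hausdorff_pre \<delta> n A =
     (INF U \<in> {U :: nat \<Rightarrow> 'a set. (\<forall>i. bounded (U i) \<and> diameter (U i) \<le> \<delta>) \<and> A \<subseteq> (\<Union>i. U i)}.
        \<Sum>i. hausdorff_content n (U i))"

definition hausdorff_outer :: "nat \<Rightarrow> 'a::metric_space set \<Rightarrow> ennreal" where
  "hausdorff_outer n A = (SUP \<delta> \<in> {0<..}. hausdorff_pre \<delta> n A)"

definition hausdorff_measure :: "nat \<Rightarrow> 'a::metric_space measure" where
  "hausdorff_measure n =
     measure_of UNIV (lambda_system UNIV UNIV (hausdorff_outer n)) (hausdorff_outer n)"

lemma hausdorff_pre_mono: "A \<subseteq> B \<Longrightarrow> hausdorff_pre \<delta> n A \<le> hausdorff_pre \<delta> n B"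
  unfolding hausdorff_pre_def by (rule INF_superset_mono) auto

lemma hausdorff_pre_empty: "0 < \<delta> \<Longrightarrow> hausdorff_pre \<delta> n {} = 0"
  unfolding hausdorff_pre_def
  by (intro antisym INF_lower2[of "\<lambda>_. {}"]) (auto simp: hausdorff_content_def)

lemma hausdorff_pre_UN_le:
  "hausdorff_pre \<delta> n (\<Union>i. A i) \<le> (\<Sum>i. hausdorff_pre \<delta> n (A (i::nat)))"
proof (rule ennreal_le_epsilon)
  fix e :: real
  assume e: "0 < e" and fin: "(\<Sum>i. hausdorff_pre \<delta> n (A i)) < top"
  have *: "hausdorff_pre \<delta> n (A i) < hausdorff_pre \<delta> n (A i) + e * (1/2)^Suc i" for i
    using e fin by (auto simp add: less_top dest!: ennreal_suminf_lessD)
  have "\<exists>U. (\<forall>j::nat. bounded (U j) \<and> diameter (U j) \<le> \<delta>) \<and> A i \<subseteq> (\<Union>j. U j) \<and>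
          (\<Sum>j. hausdorff_content n (U j)) < hausdorff_pre \<delta> n (A i) + e * (1/2)^Suc i" for i
    using *[of i] unfolding hausdorff_pre_def[of \<delta> n "A i"] INF_less_iff by auto
  then obtain U where
    U: "\<And>i j. bounded (U i (j::nat)) \<and> diameter (U i j) \<le> \<delta>"
    and cov: "\<And>i. A i \<subseteq> (\<Union>j. U i j)"
    and le: "\<And>i. (\<Sum>j. hausdorff_content n (U i j)) < hausdorff_pre \<delta> n (A i) + e * (1/2)^Suc i"
    by metis
  define V where "V k = (case prod_decode k of (i, j) \<Rightarrow> U i j)" for k
  have "(\<Union>i. A i) \<subseteq> (\<Union>k. V k)"
  proof
    fix x assume "x \<in> (\<Union>i. A i)"
    then obtain i j where "x \<in> U i j" using cov by blast
    then have "x \<in> V (prod_encode (i, j))" by (simp add: V_def)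
    then show "x \<in> (\<Union>k. V k)" by blast
  qed
  then have "hausdorff_pre \<delta> n (\<Union>i. A i) \<le> (\<Sum>k. hausdorff_content n (V k))"
    unfolding hausdorff_pre_def using U by (intro INF_lower) (auto simp: V_def split: prod.split)
  also have "\<dots> = (\<Sum>k. (\<lambda>(i, j). hausdorff_content n (U i j)) (prod_decode k))"
    by (simp add: V_def prod.case_distrib)
  also have "\<dots> = (\<Sum>i. \<Sum>j. hausdorff_content n (U i j))"
    by (rule suminf_ennreal_2dimen) simp
  also have "\<dots> \<le> (\<Sum>i. hausdorff_pre \<delta> n (A i) + e * (1/2)^Suc i)"
    using le by (intro suminf_le) (auto intro: less_imp_le)
  also have "\<dots> = (\<Sum>i. hausdorff_pre \<delta> n (A i)) + (\<Sum>i. ennreal e * ennreal ((1/2)^Suc i))"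
    using e by (subst suminf_add[symmetric])
      (auto simp del: ennreal_suminf_cmult simp add: ennreal_mult[symmetric])
  also have "(\<Sum>i. ennreal e * ennreal ((1/2)^Suc i)) = e"
    unfolding ennreal_suminf_cmult
    by (subst suminf_ennreal_eq[OF zero_le_power power_half_series]) auto
  finally show "hausdorff_pre \<delta> n (\<Union>i. A i) \<le> (\<Sum>i. hausdorff_pre \<delta> n (A i)) + ennreal e" .
qed

lemma outer_measure_space_hausdorff_outer: "outer_measure_space UNIV (hausdorff_outer n)"
  unfolding outer_measure_space_def positive_def increasing_def countably_subadditive_def
proof safe
  show "hausdorff_outer n {} = 0"
    unfolding hausdorff_outer_def by (auto simp: hausdorff_pre_empty intro!: antisym SUP_least)
  show "hausdorff_outer n A \<le> hausdorff_outer n B" if "A \<subseteq> B" for A B :: "'a set"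
    unfolding hausdorff_outer_def using that by (intro SUP_mono') (rule hausdorff_pre_mono)
  show "hausdorff_outer n (\<Union>i. A i) \<le> (\<Sum>i. hausdorff_outer n (A i))" for A :: "nat \<Rightarrow> 'a set"
    unfolding hausdorff_outer_def[of n "\<Union>i. A i"]
  proof (rule SUP_least)
    fix \<delta> :: real assume "\<delta> \<in> {0<..}"
    then have "(\<Sum>i. hausdorff_pre \<delta> n (A i)) \<le> (\<Sum>i. hausdorff_outer n (A i))"
      unfolding hausdorff_outer_def by (intro suminf_le SUP_upper) auto
    with hausdorff_pre_UN_le[of \<delta> n A] show
      "hausdorff_pre \<delta> n (\<Union>i. A i) \<le> (\<Sum>i. hausdorff_outer n (A i))" by (rule order_trans)
  qed
qed

lemma measure_space_hausdorff:
  "measure_space UNIV (lambda_system UNIV UNIV (hausdorff_outer n)) (hausdorff_outer n)"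
  using sigma_algebra.caratheodory_lemma
    [OF sigma_algebra_Pow[of UNIV], unfolded Pow_UNIV, OF outer_measure_space_hausdorff_outer] .

lemma space_hausdorff_measure: "space (hausdorff_measure n) = UNIV"
  by (simp add: hausdorff_measure_def space_measure_of_conv)

lemma sets_hausdorff_measure:
  "sets (hausdorff_measure n) = lambda_system UNIV UNIV (hausdorff_outer n)"
  using measure_space_hausdorff[of n] unfolding hausdorff_measure_def measure_space_def
  by (intro sigma_algebra.sets_measure_of_eq) blast

lemma emeasure_hausdorff_measure:
  "A \<in> sets (hausdorff_measure n) \<Longrightarrow> emeasure (hausdorff_measure n) A = hausdorff_outer n A"
  using measure_space_hausdorff[of n]
  unfolding sets_hausdorff_measure unfolding hausdorff_measure_def measure_space_def
  by (intro emeasure_measure_of_sigma) blast+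

section \<open>The reduced isosceles Schwarzschild problem\<close>

text \<open>A phase point is \<open>(R, z, P_R, P_z)\<close>, with the Euclidean metric of the product type.\<close>

type_synonym phase = "real \<times> real \<times> real \<times> real"

definition H_red ::
  "real \<Rightarrow> real \<Rightarrow> real \<Rightarrow> real \<Rightarrow> real \<Rightarrow> real \<Rightarrow> real \<Rightarrow> real \<Rightarrow> real \<Rightarrow> real \<Rightarrow> real \<Rightarrow> real" where
  "H_red M m A A1 B B1 C R z PR Pz =
     1 / M * (PR\<^sup>2 + C\<^sup>2 / R\<^sup>2) + (2 * M + m) / (4 * M * m) * Pz\<^sup>2
     - A / R - B / R ^ 3
     - 4 * A1 / (R\<^sup>2 + 4 * z\<^sup>2) powr (1/2) - 16 * B1 / (R\<^sup>2 + 4 * z\<^sup>2) powr (3/2)"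

definition phase_space :: "phase set" where
  "phase_space = {(R, z, PR, Pz). 0 < R}"

definition hamiltonian_field :: "(real \<Rightarrow> real \<Rightarrow> real \<Rightarrow> real \<Rightarrow> real) \<Rightarrow> phase \<Rightarrow> phase" where
  "hamiltonian_field H = (\<lambda>(R, z, PR, Pz).
     (deriv (\<lambda>p. H R z p Pz) PR, deriv (\<lambda>p. H R z PR p) Pz,
      - deriv (\<lambda>r. H r z PR Pz) R, - deriv (\<lambda>y. H R y PR Pz) z))"

definition solution_on ::
  "(real \<Rightarrow> real \<Rightarrow> real \<Rightarrow> real \<Rightarrow> real) \<Rightarrow> ereal \<Rightarrow> ereal \<Rightarrow> (real \<Rightarrow> phase) \<Rightarrow> bool" where
  "solution_on H a b x \<longleftrightarrow>
     (\<forall>t \<in> einterval a b.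
        x t \<in> phase_space \<and> (x has_vector_derivative hamiltonian_field H (x t)) (at t))"

definition maximal_solution ::
  "(real \<Rightarrow> real \<Rightarrow> real \<Rightarrow> real \<Rightarrow> real) \<Rightarrow> ereal \<Rightarrow> ereal \<Rightarrow> (real \<Rightarrow> phase) \<Rightarrow> bool" where
  "maximal_solution H a b x \<longleftrightarrow>
     solution_on H a b x \<and>
     (\<forall>a' b' y. a' \<le> a \<and> b \<le> b' \<and> solution_on H a' b' y \<and> (\<forall>t \<in> einterval a b. y t = x t)
        \<longrightarrow> a' = a \<and> b' = b)"

text \<open>The end \<open>b\<close> may be infinite, so the limit is taken in the extended reals.\<close>

definition leads_to_triple_collision ::
  "(real \<Rightarrow> real \<Rightarrow> real \<Rightarrow> real \<Rightarrow> real) \<Rightarrow> phase \<Rightarrow> bool" where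
  "leads_to_triple_collision H x0 \<longleftrightarrow>
     (\<exists>a b x. a < 0 \<and> 0 < b \<and> maximal_solution H a b x \<and> x 0 = x0 \<and>
        (((\<lambda>t. (fst (x t), fst (snd (x t)))) \<circ> real_of_ereal) \<longlongrightarrow> (0, 0)) (at_left b))"

definition energy_level :: "(real \<Rightarrow> real \<Rightarrow> real \<Rightarrow> real \<Rightarrow> real) \<Rightarrow> real \<Rightarrow> phase set" where
  "energy_level H h = {(R, z, PR, Pz). (R, z, PR, Pz) \<in> phase_space \<and> H R z PR Pz = h}"

text \<open>
  The induced measure on a 3-dimensional hypersurface. It also makes sense on an energy level
  containing critical points of \<open>H_red\<close>: these lie in the plane \<open>P_R = P_z = 0\<close>, a null set.
  It is complete; every set that is not measurable is given the value \<open>0\<close> by \<open>emeasure\<close>, so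
  positivity of \<open>emeasure\<close> includes measurability.
\<close>

definition hypersurface_measure :: "phase set \<Rightarrow> phase measure" where
  "hypersurface_measure S = restrict_space (hausdorff_measure 3) S"

end

theory Submission
  imports Defs
begin

text \<open>
  When \<open>R\<close> is small, the two terms of order \<open>-3\<close> in the potential dominate the centrifugal term
  \<open>C\<^sup>2 / R\<^sup>2\<close>, so angular momentum cannot prevent a collapse. In fact \<open>P_R' \<le> - 3 B / (2 R\<^sup>4)\<close> for
  small \<open>R\<close>, whatever the position of the third body. Hence a solution that starts with \<open>P_R < 0\<close> and
  \<open>P_R\<^sup>2 R\<^sup>3 > M B / 2\<close> satisfies \<open>P_R < 0\<close> and \<open>P_R\<^sup>2 R\<^sup>3 \<ge> M B / 2\<close> ever after, and \<open>R\<close> would reach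
  \<open>0\<close> in finite time. What has to be shown is that \<open>z\<close> is dragged along,
  that is, that the shape \<open>s = z / R\<close> stays bounded.

  In the time \<open>\<tau>\<close> with \<open>d\<tau> = R powr (-5/2) dt\<close> the shape obeys, up to terms of relative size \<open>R\<close>, the
  equation of an oscillator in the potential \<open>shape_well\<close>, with a coefficient of \<open>ds/d\<tau>\<close> proportional
  to \<open>R powr (3/2) * R'\<close>. As \<open>R' < 0\<close>, this term is friction. The assumption
  \<open>\<mu> > 1 + B / (16 * B1)\<close> says that \<open>shape_well\<close> has a strict local minimum at the collinear shape
  \<open>s = 0\<close>; in McGehee's picture the corresponding equilibrium of the collision manifold is a sink.
  The energy of the oscillator is \<open>R L\<^sup>2 / 2 + shape_well s\<close> with \<open>L = R\<^sup>2 s'\<close>, and the error terms can be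
  absorbed by adding a multiple of \<open>R\<close>, because \<open>R\<close> itself decreases fast enough
  (\<open>DERIV_shape_energy\<close>, \<open>trapped\<close>). So the solution cannot climb out of the well, \<open>\<bar>z\<bar> < s0 R\<close>
  persists, and both \<open>R\<close> and \<open>z\<close> tend to \<open>0\<close> (\<open>trap_leads_to_triple_collision\<close>).

  The conditions that define \<open>trap\<close> are open, and every energy level satisfies them at a collinear
  configuration \<open>z = P_z = 0\<close> with \<open>R\<close> small (\<open>ex_ball_in_trap\<close>). Thus triple collision occurs on a piece
  of the level that is a graph over a ball of \<open>(R, z, P_z)\<close>-space. The projection to that space does
  not increase distances, so the piece has positive three-dimensional Hausdorff measure
  (\<open>hausdorff_outer_pos_of_projection\<close>).

  A statement about \<open>emeasure\<close> also needs measurability of the whole set of collision orbits, which is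
  not open in general. It is obtained by cutting off the vector field outside compact boxes that exhaust
  the phase space: the flows of the truncated fields are global and continuous, and triple collision
  can be expressed through countably many closed conditions on them
  (\<open>leads_to_triple_collision_iff_flow\<close>). So the set is Borel, and Borel sets are measurable for
  Hausdorff measure by Caratheodory's criterion for metric outer measures
  (\<open>borel_sets_hausdorff_measure\<close>).
\<close>

section \<open>Hausdorff measure of Borel sets and of graphs\<close>

lemma hausdorff_outer_mono: "A \<subseteq> B \<Longrightarrow> hausdorff_outer n A \<le> hausdorff_outer n B"
  using outer_measure_space_hausdorff_outer[of n]
  by (auto simp: outer_measure_space_def increasing_def)

lemma hausdorff_outer_empty: "hausdorff_outer n {} = 0"
  using outer_measure_space_hausdorff_outer[of n]
  by (auto simp: outer_measure_space_def positive_def)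

text \<open>
  The predicate \<open>countably_subadditive\<close> speaks of disjoint families; by monotonicity, \<open>disjointed\<close>
  extends the inequality to all families.
\<close>

lemma hausdorff_outer_UN_le:
  "hausdorff_outer n (\<Union>i. A i) \<le> (\<Sum>i. hausdorff_outer n (A (i::nat)))"
proof -
  have "hausdorff_outer n (\<Union>i. disjointed A i) \<le> (\<Sum>i. hausdorff_outer n (disjointed A i))"
    using outer_measure_space_hausdorff_outer[of n] disjoint_family_disjointed[of A]
    unfolding outer_measure_space_def countably_subadditive_def by blast
  also have "\<dots> \<le> (\<Sum>i. hausdorff_outer n (A i))"
    by (intro suminf_le hausdorff_outer_mono disjointed_subset) auto
  finally show ?thesis by (simp add: UN_disjointed_eq)
qed

lemma hausdorff_outer_Un_le:
  "hausdorff_outer n (A \<union> B) \<le> hausdorff_outer n A + hausdorff_outer n B"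
proof -
  have "hausdorff_outer n (\<Union>i. binaryset A B i) \<le> (\<Sum>i. hausdorff_outer n (binaryset A B i))"
    by (rule hausdorff_outer_UN_le)
  then show ?thesis
    by (simp add: UN_binaryset_eq suminf_binaryset_eq hausdorff_outer_empty)
qed

lemma hausdorff_pre_le_outer: "0 < \<delta> \<Longrightarrow> hausdorff_pre \<delta> n A \<le> hausdorff_outer n A"
  unfolding hausdorff_outer_def by (rule SUP_upper) auto

text \<open>
  A set of diameter at most \<open>\<delta>\<close> cannot meet two sets whose distance exceeds \<open>\<delta>\<close>. So the members of a
  cover of \<open>A \<union> B\<close> split into those that serve \<open>A\<close> and those that serve \<open>B\<close>.
\<close>

lemma hausdorff_pre_separated:
  fixes A B :: "'a::metric_space set"
  assumes "0 < \<delta>" "\<delta> \<le> \<delta>1" "\<delta> \<le> \<delta>2" and sep: "\<And>x y. x \<in> A \<Longrightarrow> y \<in> B \<Longrightarrow> \<delta> < dist x y"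
  shows "hausdorff_pre \<delta>1 n A + hausdorff_pre \<delta>2 n B \<le> hausdorff_pre \<delta> n (A \<union> B)"
  unfolding hausdorff_pre_def[of \<delta> n "A \<union> B"]
proof (rule INF_greatest)
  fix U :: "nat \<Rightarrow> 'a set"
  assume "U \<in> {U. (\<forall>i. bounded (U i) \<and> diameter (U i) \<le> \<delta>) \<and> A \<union> B \<subseteq> (\<Union>i. U i)}"
  then have U: "\<And>i. bounded (U i)" "\<And>i. diameter (U i) \<le> \<delta>" and cov: "A \<union> B \<subseteq> (\<Union>i. U i)"
    by auto
  define V where "V S i = (if U i \<inter> S = {} then {} else U i)" for S i
  have V: "bounded (V S i)" "diameter (V S i) \<le> \<delta>" for S i
    using U assms(1) by (auto simp: V_def)
  have covV: "S \<subseteq> (\<Union>i. V S i)" if S: "S \<subseteq> A \<union> B" for S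
  proof
    fix x assume "x \<in> S"
    then obtain i where "x \<in> U i" using cov S by blast
    with \<open>x \<in> S\<close> have "x \<in> V S i" by (auto simp: V_def)
    then show "x \<in> (\<Union>i. V S i)" by blast
  qed
  have pre: "hausdorff_pre \<delta>' n S \<le> (\<Sum>i. hausdorff_content n (V S i))"
    if "\<delta> \<le> \<delta>'" "S \<subseteq> A \<union> B" for S \<delta>'
    unfolding hausdorff_pre_def
    using V(1) order_trans[OF V(2) that(1)] covV[OF that(2)] by (intro INF_lower) auto
  have one: "hausdorff_content n (V A i) + hausdorff_content n (V B i) \<le> hausdorff_content n (U i)" for i
  proof (cases "U i \<inter> A = {} \<or> U i \<inter> B = {}")
    case True
    then show ?thesis by (auto simp: V_def hausdorff_content_def)
  next
    case False
    then obtain x y where xy: "x \<in> U i" "x \<in> A" "y \<in> U i" "y \<in> B" by blast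
    have "dist x y \<le> \<delta>"
      using diameter_bounded_bound[OF U(1) xy(1,3)] U(2)[of i] by linarith
    with sep[OF xy(2,4)] show ?thesis by simp
  qed
  have "hausdorff_pre \<delta>1 n A + hausdorff_pre \<delta>2 n B
      \<le> (\<Sum>i. hausdorff_content n (V A i)) + (\<Sum>i. hausdorff_content n (V B i))"
    by (intro add_mono pre assms) auto
  also have "\<dots> = (\<Sum>i. hausdorff_content n (V A i) + hausdorff_content n (V B i))"
    by (rule suminf_add) auto
  also have "\<dots> \<le> (\<Sum>i. hausdorff_content n (U i))"
    by (intro suminf_le one) auto
  finally show "hausdorff_pre \<delta>1 n A + hausdorff_pre \<delta>2 n B \<le> (\<Sum>i. hausdorff_content n (U i))" .
qed

text \<open>
  Additivity on sets at positive distance makes Hausdorff outer measure a metric outer measure,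
  which is what the criterion of Caratheodory asks for.
\<close>

lemma hausdorff_outer_separated:
  assumes "0 < d" and sep: "\<And>x y. x \<in> A \<Longrightarrow> y \<in> B \<Longrightarrow> d \<le> dist x y"
  shows "hausdorff_outer n A + hausdorff_outer n B \<le> hausdorff_outer n (A \<union> B)"
proof -
  have *: "hausdorff_pre \<delta>1 n A + hausdorff_pre \<delta>2 n B \<le> hausdorff_outer n (A \<union> B)"
    if "0 < \<delta>1" "0 < \<delta>2" for \<delta>1 \<delta>2
  proof -
    have "hausdorff_pre \<delta>1 n A + hausdorff_pre \<delta>2 n B
        \<le> hausdorff_pre (min (d/2) (min \<delta>1 \<delta>2)) n (A \<union> B)"
    proof (rule hausdorff_pre_separated)
      show "min (d/2) (min \<delta>1 \<delta>2) < dist x y" if "x \<in> A" "y \<in> B" for x y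
        using sep[OF that] \<open>0 < d\<close> by linarith
    qed (use that \<open>0 < d\<close> in auto)
    also have "\<dots> \<le> hausdorff_outer n (A \<union> B)"
      using that assms by (intro hausdorff_pre_le_outer) auto
    finally show ?thesis .
  qed
  show ?thesis
    unfolding hausdorff_outer_def[of n A] hausdorff_outer_def[of n B]
    by (subst ennreal_SUP_add_left[symmetric], simp,
        rule SUP_least, subst ennreal_SUP_add_right, simp, rule SUP_least, rule *) auto
qed

lemma hausdorff_outer_separated_sum:
  fixes B :: "nat \<Rightarrow> 'a::metric_space set"
  assumes sep: "\<And>k. \<exists>d>0. \<forall>i<k. \<forall>x\<in>B i. \<forall>y\<in>B k. d \<le> dist x y"
  shows "(\<Sum>i<k. hausdorff_outer n (B i)) \<le> hausdorff_outer n (\<Union>i<k. B i)"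
proof (induction k)
  case (Suc k)
  from sep obtain d where d: "d > 0" "\<forall>i<k. \<forall>x\<in>B i. \<forall>y\<in>B k. d \<le> dist x y" by blast
  have "(\<Sum>i<Suc k. hausdorff_outer n (B i)) \<le> hausdorff_outer n (\<Union>i<k. B i) + hausdorff_outer n (B k)"
    using Suc by (auto intro: add_right_mono)
  also have "\<dots> \<le> hausdorff_outer n ((\<Union>i<k. B i) \<union> B k)"
    using d by (intro hausdorff_outer_separated[of d]) auto
  finally show ?case by (simp add: lessThan_Suc Un_commute)
qed simp

lemma ennreal_suminf_tail_tendsto_0:
  fixes f :: "nat \<Rightarrow> ennreal"
  assumes "(\<Sum>i. f i) < top"
  shows "(\<lambda>k. \<Sum>i. f (i + k)) \<longlonglongrightarrow> 0"
proof -
  have eq: "(\<Sum>i. f (i + k)) = (\<Sum>i. f i) - (\<Sum>i<k. f i)" for k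
  proof -
    have "(\<Sum>i. f i) = (\<Sum>i. f (i + k)) + (\<Sum>i<k. f i)" by (intro suminf_offset) auto
    moreover have "(\<Sum>i<k. f i) < top"
      by (rule le_less_trans[OF sum_le_suminf assms]) auto
    ultimately show ?thesis by (metis ennreal_add_diff_cancel_right less_top)
  qed
  have "(\<lambda>k. (\<Sum>i. f i) - (\<Sum>i<k. f i)) \<longlonglongrightarrow> (\<Sum>i. f i) - (\<Sum>i. f i)"
    using assms by (intro tendsto_diff_ennreal tendsto_const summable_LIMSEQ) auto
  then show ?thesis using assms by (simp add: eq)
qed

text \<open>
  The outer measure is additive on \<open>F \<inter> A\<close> and the part \<open>S k\<close> of \<open>A\<close> at distance at least \<open>1 / Suc k\<close>
  from \<open>F\<close>. The part of \<open>A\<close> outside \<open>F\<close> that \<open>S k\<close> misses is a union of shells \<open>D i\<close>. Shells whose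
  indices differ by at least \<open>2\<close> are at positive distance from each other, so the measures of all shells have a
  finite sum as soon as \<open>A\<close> has finite measure, and the missed part becomes negligible as \<open>k\<close> grows.
\<close>

lemma closed_sets_hausdorff_measure:
  fixes F :: "'a::metric_space set"
  assumes "closed F"
  shows "F \<in> sets (hausdorff_measure n)"
proof (cases "F = {}")
  case True
  then show ?thesis by simp
next
  case ne: False
  let ?\<mu> = "hausdorff_outer n :: 'a set \<Rightarrow> ennreal"
  have main: "?\<mu> (F \<inter> A) + ?\<mu> ((UNIV - F) \<inter> A) \<le> ?\<mu> A" for A
  proof (cases "?\<mu> A = top")
    case False
    define S where "S k = {x \<in> A. 1 / Suc k \<le> infdist x F}" for k
    define D where "D k = S (Suc k) - S k" for k
    have Ssub: "S k \<subseteq> A" and Dsub: "D k \<subseteq> A" for k by (auto simp: S_def D_def)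
    have anti: "1 / real (Suc j) \<le> 1 / real (Suc i)" if "i \<le> j" for i j
      using that by (simp add: field_simps)
    have Smono: "S i \<subseteq> S j" if "i \<le> j" for i j
      using anti[OF that] by (auto simp: S_def)
    have ex: "\<exists>k. x \<in> S k" if "x \<in> A - F" for x
    proof -
      have "infdist x F > 0"
        using infdist_pos_not_in_closed[OF assms ne] that by auto
      then obtain k where "inverse (Suc k) < infdist x F" using reals_Archimedean by blast
      with that show ?thesis by (auto simp: S_def inverse_eq_divide intro!: exI[of _ k])
    qed
    have cover: "A - F \<subseteq> S k \<union> (\<Union>i. D (i + k))" for k
    proof
      fix x assume x: "x \<in> A - F"
      define j where "j = (LEAST j. x \<in> S j)"
      have j: "x \<in> S j" unfolding j_def using ex[OF x] by (rule LeastI_ex)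
      show "x \<in> S k \<union> (\<Union>i. D (i + k))"
      proof (cases "j \<le> k")
        case True then show ?thesis using Smono j by blast
      next
        case False
        then obtain i where i: "j = Suc (i + k)" by (metis add.commute less_imp_Suc_add not_le)
        have "x \<notin> S (i + k)" using not_less_Least[of "i + k" "\<lambda>j. x \<in> S j"] i by (auto simp: j_def)
        then have "x \<in> D (i + k)" using j i by (auto simp: D_def)
        then show ?thesis by blast
      qed
    qed
    have near: "infdist x F \<le> infdist y F + dist x y" for x y
      using infdist_triangle[of x F y] by simp
    have Dsep: "1 / Suc (Suc i) - 1 / Suc j \<le> dist x y" if "x \<in> D i" "y \<in> D j" for i j x y
    proof -
      have "1 / Suc (Suc i) \<le> infdist x F" "infdist y F < 1 / Suc j"
        using that by (auto simp: D_def S_def)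
      with near[of x y] show ?thesis by linarith
    qed
    \<comment> \<open>every second shell: neighbouring shells touch, but \<open>D (2 i)\<close> and \<open>D (2 i + 2)\<close> are
        at positive distance\<close>
    have half: "(\<Sum>i. ?\<mu> (D (2 * i + r))) \<le> ?\<mu> A" for r
    proof (rule suminf_le_const)
      fix k
      have "(\<Sum>i<k. ?\<mu> (D (2 * i + r))) \<le> ?\<mu> (\<Union>i<k. D (2 * i + r))"
      proof (rule hausdorff_outer_separated_sum)
        fix k
        show "\<exists>d>0. \<forall>i<k. \<forall>x\<in>D (2 * i + r). \<forall>y\<in>D (2 * k + r). d \<le> dist x y"
        proof (cases "k = 0")
          case True
          then show ?thesis by (auto intro: exI[of _ 1])
        next
          case False
          have pos: "1 / real (Suc (2 * k + r)) < 1 / real (Suc (2 * k + r - 1))"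
            by (rule frac_less2) (use False in linarith)+
          show ?thesis
          proof (intro exI[of _ "1 / Suc (2 * k + r - 1) - 1 / Suc (2 * k + r)"] conjI allI impI ballI)
            show "0 < 1 / real (Suc (2 * k + r - 1)) - 1 / real (Suc (2 * k + r))" using pos by linarith
            fix i x y assume i: "i < k" and xy: "x \<in> D (2 * i + r)" "y \<in> D (2 * k + r)"
            have "1 / real (Suc (2 * k + r - 1)) \<le> 1 / real (Suc (Suc (2 * i + r)))"
              using i by (intro anti) auto
            with Dsep[OF xy] show "1 / real (Suc (2 * k + r - 1)) - 1 / real (Suc (2 * k + r)) \<le> dist x y"
              by linarith
          qed
        qed
      qed
      also have "\<dots> \<le> ?\<mu> A" using Dsub by (intro hausdorff_outer_mono) blast
      finally show "(\<Sum>i<k. ?\<mu> (D (2 * i + r))) \<le> ?\<mu> A" .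
    qed auto
    have "(\<Sum>i. ?\<mu> (D i)) \<le> ?\<mu> A + ?\<mu> A"
    proof (rule suminf_le_const)
      fix k
      have "(\<Sum>i<k. ?\<mu> (D i)) \<le> (\<Sum>i<2*k. ?\<mu> (D i))"
        by (intro sum_mono2) auto
      also have "\<dots> = (\<Sum>i<k. ?\<mu> (D (2 * i + 0))) + (\<Sum>i<k. ?\<mu> (D (2 * i + 1)))"
        by (induction k) (auto simp: algebra_simps)
      also have "\<dots> \<le> ?\<mu> A + ?\<mu> A"
        by (intro add_mono order_trans[OF sum_le_suminf half]) auto
      finally show "(\<Sum>i<k. ?\<mu> (D i)) \<le> ?\<mu> A + ?\<mu> A" .
    qed auto
    then have fin: "(\<Sum>i. ?\<mu> (D i)) < top"
      using False by (auto simp: less_top[symmetric] top_unique)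
    have bound: "?\<mu> (F \<inter> A) + ?\<mu> ((UNIV - F) \<inter> A) \<le> ?\<mu> A + (\<Sum>i. ?\<mu> (D (i + k)))" for k
    proof -
      have "?\<mu> ((UNIV - F) \<inter> A) \<le> ?\<mu> (S k \<union> (\<Union>i. D (i + k)))"
        using cover[of k] by (intro hausdorff_outer_mono) auto
      also have "\<dots> \<le> ?\<mu> (S k) + ?\<mu> (\<Union>i. D (i + k))"
        by (rule hausdorff_outer_Un_le)
      also have "\<dots> \<le> ?\<mu> (S k) + (\<Sum>i. ?\<mu> (D (i + k)))"
        by (intro add_left_mono hausdorff_outer_UN_le)
      finally have "?\<mu> (F \<inter> A) + ?\<mu> ((UNIV - F) \<inter> A) \<le> ?\<mu> (F \<inter> A) + ?\<mu> (S k) + (\<Sum>i. ?\<mu> (D (i + k)))"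
        by (metis add.assoc add_left_mono)
      also have "?\<mu> (F \<inter> A) + ?\<mu> (S k) \<le> ?\<mu> ((F \<inter> A) \<union> S k)"
      proof (rule hausdorff_outer_separated[of "1 / Suc k"])
        fix x y assume "x \<in> F \<inter> A" "y \<in> S k"
        then show "1 / real (Suc k) \<le> dist x y"
          using infdist_le[of x F y] by (auto simp: S_def dist_commute)
      qed simp
      also have "\<dots> \<le> ?\<mu> A" using Ssub by (intro hausdorff_outer_mono) auto
      finally show ?thesis by (auto intro: add_right_mono)
    qed
    have "(\<lambda>k. ?\<mu> A + (\<Sum>i. ?\<mu> (D (i + k)))) \<longlonglongrightarrow> ?\<mu> A + 0"
      by (intro tendsto_add tendsto_const ennreal_suminf_tail_tendsto_0 fin)
    then show ?thesis using bound by (auto intro: LIMSEQ_le_const)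
  qed simp
  show ?thesis
    unfolding sets_hausdorff_measure lambda_system_def
  proof safe
    fix A :: "'a set"
    have "?\<mu> A = ?\<mu> ((F \<inter> A) \<union> ((UNIV - F) \<inter> A))" by (rule arg_cong[where f = ?\<mu>]) auto
    also have "\<dots> \<le> ?\<mu> (F \<inter> A) + ?\<mu> ((UNIV - F) \<inter> A)" by (rule hausdorff_outer_Un_le)
    finally show "?\<mu> (F \<inter> A) + ?\<mu> ((UNIV - F) \<inter> A) = ?\<mu> A" using main[of A] by (rule antisym[rotated])
  qed simp
qed

lemma borel_sets_hausdorff_measure:
  assumes "S \<in> sets borel"
  shows "S \<in> sets (hausdorff_measure n)"
proof -
  have "sets borel = sigma_sets UNIV (Collect closed :: 'a set set)"
    by (simp add: borel_eq_closed)
  also have "\<dots> \<subseteq> sets (hausdorff_measure n)"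
    unfolding space_hausdorff_measure[of n, symmetric]
    by (rule sets.sigma_sets_subset) (auto intro: closed_sets_hausdorff_measure)
  finally show ?thesis using assms by blast
qed

text \<open>
  The image of a set of diameter \<open>d\<close> lies in a ball of radius \<open>d\<close>, whose volume is \<open>2 ^ n\<close> times the
  content of the set. So covers of \<open>S\<close> cannot have less content than a fixed fraction of the Lebesgue
  measure of a ball inside the projection of \<open>S\<close>.
\<close>

lemma hausdorff_outer_pos_of_projection:
  fixes \<pi> :: "'a::metric_space \<Rightarrow> 'b::euclidean_space"
  assumes lip: "\<And>x y. x \<in> S \<Longrightarrow> y \<in> S \<Longrightarrow> dist (\<pi> x) (\<pi> y) \<le> dist x y"
    and r: "0 < r" "ball c r \<subseteq> \<pi> ` S"
  shows "0 < hausdorff_outer DIM('b) S"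
proof -
  let ?n = "DIM('b)"
  let ?v = "unit_ball_vol (real ?n) * (r / 2) ^ ?n"
  have "emeasure lborel (ball c r) = ennreal (2 ^ ?n * ?v)"
    using r(1) by (simp add: emeasure_ball power_divide)
  then have vol: "emeasure lborel (ball c r) = 2 ^ ?n * ennreal ?v"
    using r(1) by (simp add: ennreal_mult ennreal_power[symmetric])
  have "ennreal ?v \<le> hausdorff_pre 1 ?n S"
    unfolding hausdorff_pre_def
  proof (rule INF_greatest)
    fix U :: "nat \<Rightarrow> 'a set"
    assume "U \<in> {U. (\<forall>i. bounded (U i) \<and> diameter (U i) \<le> 1) \<and> S \<subseteq> (\<Union>i. U i)}"
    then have U: "\<And>i. bounded (U i)" and cov: "S \<subseteq> (\<Union>i. U i)" by auto
    define K where "K i = (if U i \<inter> S = {} then {} else cball (\<pi> (SOME a. a \<in> U i \<inter> S)) (diameter (U i)))" for i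
    have "\<pi> ` S \<subseteq> (\<Union>i. K i)"
    proof
      fix y assume "y \<in> \<pi> ` S"
      then obtain x where x: "x \<in> S" "y = \<pi> x" by blast
      with cov obtain i where i: "x \<in> U i" by blast
      define a where "a = (SOME a. a \<in> U i \<inter> S)"
      have a: "a \<in> U i \<inter> S" unfolding a_def by (rule someI[of _ x]) (use x(1) i in blast)
      have "dist (\<pi> a) (\<pi> x) \<le> dist a x" using a x by (intro lip) auto
      also have "\<dots> \<le> diameter (U i)" using a i U by (intro diameter_bounded_bound) auto
      finally have "y \<in> K i" using x i by (auto simp: K_def a_def)
      then show "y \<in> (\<Union>i. K i)" by blast
    qed
    then have "emeasure lborel (ball c r) \<le> emeasure lborel (\<Union>i. K i)"
      using r(2) by (intro emeasure_mono) (auto simp: K_def)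
    also have "\<dots> \<le> (\<Sum>i. emeasure lborel (K i))"
      by (intro emeasure_subadditive_countably) (auto simp: K_def)
    also have "\<dots> \<le> (\<Sum>i. 2 ^ ?n * hausdorff_content ?n (U i))"
    proof (intro suminf_le summableI)
      fix i
      show "emeasure lborel (K i) \<le> 2 ^ ?n * hausdorff_content ?n (U i)"
      proof (cases "U i \<inter> S = {}")
        case False
        have d: "0 \<le> diameter (U i)" using U by (rule diameter_ge_0)
        have "emeasure lborel (K i) = ennreal (unit_ball_vol (real ?n) * diameter (U i) ^ ?n)"
          using False d by (simp add: K_def emeasure_cball)
        also have "unit_ball_vol (real ?n) * diameter (U i) ^ ?n
            = 2 ^ ?n * (unit_ball_vol (real ?n) * (diameter (U i) / 2) ^ ?n)"
          by (simp add: power_divide)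
        also have "ennreal \<dots> = 2 ^ ?n * ennreal (unit_ball_vol (real ?n) * (diameter (U i) / 2) ^ ?n)"
          using d by (simp add: ennreal_mult ennreal_power[symmetric])
        also have "\<dots> = 2 ^ ?n * hausdorff_content ?n (U i)"
          using False by (auto simp: hausdorff_content_def)
        finally show ?thesis by simp
      qed (simp add: K_def)
    qed
    also have "\<dots> = 2 ^ ?n * (\<Sum>i. hausdorff_content ?n (U i))" by (rule ennreal_suminf_cmult)
    finally show "ennreal ?v \<le> (\<Sum>i. hausdorff_content ?n (U i))"
      unfolding vol by (subst (asm) ennreal_mult_le_mult_iff) (auto simp: power_eq_top_ennreal)
  qed
  moreover have "0 < ennreal ?v" using r(1) by simp
  ultimately have "0 < hausdorff_pre 1 ?n S" by (rule less_le_trans[rotated])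
  then show ?thesis using hausdorff_pre_le_outer[of 1 ?n S] by (auto intro: less_le_trans)
qed

section \<open>Globally Lipschitz differential equations\<close>

lemma antiderivative_from_0:
  fixes f :: "real \<Rightarrow> 'a::euclidean_space"
  assumes "continuous_on UNIV f"
  shows "\<exists>F. F 0 = 0 \<and> (\<forall>t. (F has_vector_derivative f t) (at t))"
proof -
  have "isCont f x" for x using assms continuous_on_eq_continuous_at by blast
  with einterval_antiderivative[of "-\<infinity>" "\<infinity>" f]
  obtain F where F: "\<And>t::real. (F has_vector_derivative f t) (at t)" by auto
  then have "((\<lambda>t. F t - F 0) has_vector_derivative f t) (at t)" for t
    by (auto intro!: derivative_eq_intros)
  then show ?thesis by (intro exI[of _ "\<lambda>t. F t - F 0"]) auto
qed

text \<open>
  A mean value inequality on both sides of \<open>0\<close> at once, for majorants that depend on \<open>\<bar>t\<bar>\<close>.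
\<close>

lemma norm_le_if_derivative_bounded:
  fixes D :: "real \<Rightarrow> 'a::euclidean_space"
  assumes D: "\<And>t. (D has_vector_derivative D' t) (at t)" and D0: "D 0 = 0"
    and bnd: "\<And>t. norm (D' t) \<le> d \<bar>t\<bar>"
    and g: "\<And>t. (g has_real_derivative d t) (at t)"
  shows "norm (D t) \<le> g \<bar>t\<bar> - g 0"
proof -
  have D_cont: "continuous_on S D" for S
    using D by (meson continuous_at_imp_continuous_on has_vector_derivative_continuous)
  have g_cont: "continuous_on S g" for S
    using g by (meson DERIV_isCont continuous_at_imp_continuous_on)
  consider "t = 0" | "0 < t" | "t < 0" by linarith
  then show ?thesis
  proof cases
    case 1 then show ?thesis using D0 by simp
  next
    case 2
    have "norm (D t - D 0) \<le> g t - g 0"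
    proof (rule differentiable_bound_general[of 0 t D g D' d])
      show "norm (D' x) \<le> d x" if "0 < x" "x < t" for x
        using bnd[of x] that by simp
    qed (use 2 D g D_cont g_cont in \<open>auto simp: has_real_derivative_iff_has_vector_derivative\<close>)
    with 2 D0 show ?thesis by simp
  next
    case 3
    have "norm (D 0 - D t) \<le> - g (- 0) - - g (- t)"
    proof (rule differentiable_bound_general[of t 0 D "\<lambda>s. - g (- s)" D' "\<lambda>s. d (- s)"])
      show "norm (D' x) \<le> d (- x)" if "t < x" "x < 0" for x
        using bnd[of x] that by simp
      show "((\<lambda>s. - g (- s)) has_vector_derivative d (- x)) (at x)" for x
        unfolding has_real_derivative_iff_has_vector_derivative[symmetric]
        by (auto intro!: derivative_eq_intros DERIV_chain2[OF g])
      show "continuous_on {t..0} (\<lambda>s. - g (- s))"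
        by (intro continuous_intros continuous_on_compose2[OF g_cont[of UNIV]]) auto
    qed (use 3 D D_cont in auto)
    with 3 D0 show ?thesis by simp
  qed
qed

text \<open>
  The integral equation is solved by a contraction on the whole real line at once. With the weight
  \<open>w t = exp (2 * K * \<bar>t\<bar>)\<close> of Bielecki, where \<open>K\<close> is a Lipschitz constant, the unknown is the bounded function
  \<open>y = (x - x0) / w\<close>, and integrating \<open>K * w\<close> gives back only half of \<open>w\<close>. This is where the contraction
  factor \<open>1/2\<close> comes from.
\<close>

theorem ex_global_solution:
  fixes G :: "'a::euclidean_space \<Rightarrow> 'a"
  assumes lip: "L-lipschitz_on UNIV G" and bounded: "bounded (range G)"
  shows "\<exists>x. x 0 = x0 \<and> (\<forall>t. (x has_vector_derivative G (x t)) (at t))"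
proof -
  have "\<exists>K. 0 < K \<and> K-lipschitz_on UNIV G"
    using lip by (intro exI[of _ "max L 1"]) (auto intro: lipschitz_on_mono)
  then obtain K where K: "0 < K" and lipK: "K-lipschitz_on UNIV G" by blast
  from bounded obtain N where N: "\<And>x. norm (G x) \<le> N" by (auto simp: bounded_iff)
  have N0: "0 \<le> N" using N[of 0] norm_ge_zero order_trans by blast
  define w where "w t = exp (2 * K * \<bar>t\<bar>)" for t
  have w_cont: "continuous_on UNIV w" unfolding w_def by (intro continuous_intros)
  have w_pos: "0 < w t" and w_lb: "K * \<bar>t\<bar> \<le> w t" for t
  proof -
    have "2 * K * \<bar>t\<bar> < exp (2 * K * \<bar>t\<bar>)" using exp_ge_add_one_self[of "2 * K * \<bar>t\<bar>"] by linarith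
    moreover have "0 \<le> K * \<bar>t\<bar>" using K by simp
    ultimately show "K * \<bar>t\<bar> \<le> w t" unfolding w_def by linarith
  qed (simp add: w_def)
  have G_cont: "continuous_on UNIV G" using lip by (rule lipschitz_on_continuous_on)
  have rhs_cont: "continuous_on UNIV (\<lambda>s. G (x0 + w s *\<^sub>R apply_bcontfun y s))" for y
    by (intro continuous_intros continuous_on_compose2[OF G_cont] w_cont) auto
  have "\<forall>y. \<exists>F. F 0 = 0 \<and> (\<forall>t. (F has_vector_derivative G (x0 + w t *\<^sub>R apply_bcontfun y t)) (at t))"
    using antiderivative_from_0[OF rhs_cont] by blast
  then obtain F where F0: "\<And>y. F y 0 = 0"
    and F: "\<And>y t. (F y has_vector_derivative G (x0 + w t *\<^sub>R apply_bcontfun y t)) (at t)"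
    by metis
  have F_bound: "norm (F y t) \<le> N * \<bar>t\<bar>" for y t
    using norm_le_if_derivative_bounded[of "F y" _ "\<lambda>_. N" "\<lambda>t. N * t" t, OF F F0] N
    by (auto intro!: derivative_eq_intros)
  \<comment> \<open>the field is bounded by \<open>N\<close>, so \<open>F y\<close> grows at most linearly and is dominated by the weight\<close>
  have Phi: "(\<lambda>t. F y t /\<^sub>R w t) \<in> bcontfun" for y
  proof (rule bcontfun_normI)
    have "continuous_on UNIV (F y)"
      using F by (meson continuous_at_imp_continuous_on has_vector_derivative_continuous)
    then show "continuous_on UNIV (\<lambda>t. F y t /\<^sub>R w t)"
      using w_pos by (intro continuous_intros w_cont) (auto simp: less_imp_neq[symmetric])
    show "norm (F y t /\<^sub>R w t) \<le> N / K" for t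
    proof -
      have "norm (F y t /\<^sub>R w t) = norm (F y t) / w t" using w_pos[of t] by (simp add: divide_inverse)
      also have "\<dots> \<le> N * \<bar>t\<bar> / w t" using F_bound w_pos[of t] by (simp add: divide_right_mono)
      also have "\<dots> \<le> N / K"
        using mult_left_mono[OF w_lb[of t] N0] w_pos[of t] K by (simp add: field_simps)
      finally show ?thesis .
    qed
  qed
  define \<Phi> where "\<Phi> y = Bcontfun (\<lambda>t. F y t /\<^sub>R w t)" for y
  have app: "apply_bcontfun (\<Phi> y) t = F y t /\<^sub>R w t" for y t
    unfolding \<Phi>_def using Phi by (simp add: Bcontfun_inverse)
  have contr: "dist (\<Phi> y) (\<Phi> z) \<le> 1/2 * dist y z" for y z
  proof (rule dist_bound)
    fix t
    have "norm (F y t - F z t) \<le> dist y z / 2 * exp (2 * K * \<bar>t\<bar>) - dist y z / 2 * exp (2 * K * 0)"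
    proof (rule norm_le_if_derivative_bounded[of "\<lambda>t. F y t - F z t"
          "\<lambda>t. G (x0 + w t *\<^sub>R apply_bcontfun y t) - G (x0 + w t *\<^sub>R apply_bcontfun z t)"
          "\<lambda>t. K * dist y z * exp (2 * K * t)" "\<lambda>t. dist y z / 2 * exp (2 * K * t)"])
      fix t
      show "((\<lambda>t. F y t - F z t) has_vector_derivative
          G (x0 + w t *\<^sub>R apply_bcontfun y t) - G (x0 + w t *\<^sub>R apply_bcontfun z t)) (at t)"
        by (intro has_vector_derivative_diff F)
      have "norm (G (x0 + w t *\<^sub>R apply_bcontfun y t) - G (x0 + w t *\<^sub>R apply_bcontfun z t))
          \<le> K * norm ((x0 + w t *\<^sub>R apply_bcontfun y t) - (x0 + w t *\<^sub>R apply_bcontfun z t))"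
        by (rule lipschitz_on_normD[OF lipK]) auto
      also have "(x0 + w t *\<^sub>R apply_bcontfun y t) - (x0 + w t *\<^sub>R apply_bcontfun z t)
          = w t *\<^sub>R (apply_bcontfun y t - apply_bcontfun z t)"
        by (simp add: algebra_simps)
      also have "norm \<dots> = w t * dist (apply_bcontfun y t) (apply_bcontfun z t)"
        using w_pos[of t] by (simp add: dist_norm)
      also have "\<dots> \<le> w t * dist y z"
        using w_pos[of t] by (intro mult_left_mono dist_bounded) auto
      finally show "norm (G (x0 + w t *\<^sub>R apply_bcontfun y t) - G (x0 + w t *\<^sub>R apply_bcontfun z t))
          \<le> K * dist y z * exp (2 * K * \<bar>t\<bar>)"
        using K by (simp add: w_def mult_ac)
      show "((\<lambda>t. dist y z / 2 * exp (2 * K * t)) has_real_derivative K * dist y z * exp (2 * K * t)) (at t)"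
        by (auto intro!: derivative_eq_intros)
    qed (simp add: F0)
    also have "\<dots> \<le> dist y z / 2 * w t" by (simp add: w_def)
    finally have *: "norm (F y t - F z t) \<le> dist y z / 2 * w t" .
    have "dist (apply_bcontfun (\<Phi> y) t) (apply_bcontfun (\<Phi> z) t) = norm (F y t - F z t) / w t"
      using w_pos[of t]
      by (simp add: app dist_norm divide_inverse flip: scaleR_diff_right)
    also have "\<dots> \<le> 1/2 * dist y z" using * w_pos[of t] by (simp add: field_simps)
    finally show "dist (apply_bcontfun (\<Phi> y) t) (apply_bcontfun (\<Phi> z) t) \<le> 1/2 * dist y z" .
  qed
  have "\<exists>!y. \<Phi> y = y" using contr by (intro banach_fix_type[of "1/2"]) auto
  then obtain y where y: "\<Phi> y = y" by blast
  have wy: "w t *\<^sub>R apply_bcontfun y t = F y t" for t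
    using app[of y t] w_pos[of t] by (simp add: y)
  show ?thesis
  proof (intro exI[of _ "\<lambda>t. x0 + F y t"] conjI allI)
    show "((\<lambda>t. x0 + F y t) has_vector_derivative G (x0 + F y t)) (at t)" for t
      using F[of y t] by (auto simp: wy intro!: derivative_eq_intros)
  qed (simp add: F0)
qed

text \<open>
  Gronwall's estimate: \<open>exp (- 2 * L * t) * (norm (x t - y t))\<^sup>2\<close> is nonincreasing. It yields both
  uniqueness and continuous dependence on initial values.
\<close>

lemma solutions_dist_le:
  fixes x y :: "real \<Rightarrow> 'a::euclidean_space"
  assumes lip: "L-lipschitz_on S G" and "0 \<le> T"
    and x: "continuous_on {0..T} x" "\<And>t. 0 < t \<Longrightarrow> t < T \<Longrightarrow> (x has_vector_derivative G (x t)) (at t)"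
    and y: "continuous_on {0..T} y" "\<And>t. 0 < t \<Longrightarrow> t < T \<Longrightarrow> (y has_vector_derivative G (y t)) (at t)"
    and S: "\<And>t. 0 < t \<Longrightarrow> t < T \<Longrightarrow> x t \<in> S \<and> y t \<in> S"
  shows "dist (x T) (y T) \<le> exp (L * T) * dist (x 0) (y 0)"
proof -
  define u where "u t = exp (- 2 * L * t) * ((x t - y t) \<bullet> (x t - y t))" for t
  have "u T \<le> u 0"
  proof (rule DERIV_nonpos_imp_decreasing_open[OF \<open>0 \<le> T\<close>])
    fix t assume t: "0 < t" "t < T"
    let ?d = "x t - y t"
    have D: "(u has_real_derivative
        exp (- 2 * L * t) * (2 * (?d \<bullet> (G (x t) - G (y t))) - 2 * L * (?d \<bullet> ?d))) (at t)"
    proof -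
      have d: "((\<lambda>t. x t - y t) has_vector_derivative (G (x t) - G (y t))) (at t)"
        by (intro has_vector_derivative_diff x(2) y(2) t)
      have "((\<lambda>t. (x t - y t) \<bullet> (x t - y t)) has_real_derivative 2 * (?d \<bullet> (G (x t) - G (y t)))) (at t)"
        using bounded_bilinear.has_vector_derivative[OF bounded_bilinear_inner d d]
        by (simp add: has_real_derivative_iff_has_vector_derivative inner_commute)
      moreover have "((\<lambda>t. exp (- 2 * L * t)) has_real_derivative - 2 * L * exp (- 2 * L * t)) (at t)"
        by (auto intro!: derivative_eq_intros)
      ultimately show ?thesis
        unfolding u_def by (rule DERIV_cong[OF DERIV_mult[rotated]]) (simp add: ring_distribs mult_ac)
    qed
    have "?d \<bullet> (G (x t) - G (y t)) \<le> norm ?d * norm (G (x t) - G (y t))"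
      by (rule norm_cauchy_schwarz)
    also have "\<dots> \<le> norm ?d * (L * norm ?d)"
      using S[OF t] by (intro mult_left_mono lipschitz_on_normD[OF lip]) auto
    also have "\<dots> = L * (?d \<bullet> ?d)" by (simp add: dot_square_norm power2_eq_square)
    finally have "2 * (?d \<bullet> (G (x t) - G (y t))) - 2 * L * (?d \<bullet> ?d) \<le> 0" by simp
    with D show "\<exists>d. (u has_real_derivative d) (at t) \<and> d \<le> 0"
      by (intro exI conjI) (auto simp: mult_le_0_iff)
  next
    show "continuous_on {0..T} u" unfolding u_def by (intro continuous_intros x y)
  qed
  then have "(norm (x T - y T))\<^sup>2 \<le> (exp (L * T) * norm (x 0 - y 0))\<^sup>2"
    by (simp add: u_def dot_square_norm power_mult_distrib exp_minus field_simps flip: exp_double)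
  then show ?thesis
    by (simp add: dist_norm power2_le_iff_abs_le)
qed

section \<open>Maximal solutions in phase space\<close>

text \<open>
  Compact boxes, each in the interior of the next, that exhaust the phase space. As boxes they carry
  the nonexpansive retraction \<open>clamp\<close>.
\<close>

definition phase_box :: "nat \<Rightarrow> phase set" where
  "phase_box n = (let N = real n + 1 in {1/N..N} \<times> {-N..N} \<times> {-N..N} \<times> {-N..N})"

lemma phase_box_cbox:
  "phase_box n = (let N = real n + 1 in cbox (1/N, -N, -N, -N) (N, N, N, N))"
  by (simp add: phase_box_def Let_def cbox_Pair_eq)

lemma compact_phase_box: "compact (phase_box n)"
  by (simp add: phase_box_cbox Let_def)

lemma closed_phase_box: "closed (phase_box n)"
  by (simp add: compact_phase_box compact_imp_closed)

lemma phase_box_subset: "phase_box n \<subseteq> phase_space"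
  by (auto simp: phase_box_def phase_space_def Let_def intro: less_le_trans[rotated])

lemma interior_phase_box:
  "interior (phase_box n) = (let N = real n + 1 in {1/N<..<N} \<times> {-N<..<N} \<times> {-N<..<N} \<times> {-N<..<N})"
  by (simp add: phase_box_def Let_def interior_Times)

lemma phase_box_Suc: "phase_box n \<subseteq> interior (phase_box (Suc n))"
proof -
  have "1 / (2 + real n) < 1 / (1 + real n)" by (simp add: frac_less2)
  then show ?thesis
    unfolding interior_phase_box unfolding phase_box_def Let_def by (auto simp: add.commute)
qed

lemma phase_box_mono: "m \<le> n \<Longrightarrow> phase_box m \<subseteq> phase_box n"
proof (induction n rule: dec_induct)
  case (step n)
  then show ?case using phase_box_Suc[of n] interior_subset by blast
qed auto

lemma phase_box_exhausts:
  assumes "x \<in> phase_space"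
  shows "\<exists>n. x \<in> phase_box n"
proof -
  obtain R z p q where x: "x = (R, z, p, q)" by (cases x)
  then have R: "R > 0" using assms by (simp add: phase_space_def)
  obtain n :: nat where n: "max (max (1/R) R) (max \<bar>z\<bar> (max \<bar>p\<bar> \<bar>q\<bar>)) \<le> real n"
    using real_arch_simple by blast
  then have "1 \<le> real n * R" using R by (simp add: field_simps)
  then have "1 / (real n + 1) \<le> R" using R by (simp add: field_simps)
  with n show ?thesis by (intro exI[of _ n]) (auto simp: x phase_box_def Let_def)
qed

lemma compact_subset_phase_box:
  assumes "compact S" "S \<subseteq> phase_space"
  shows "\<exists>n. S \<subseteq> phase_box n"
proof -
  have "S \<subseteq> (\<Union>n\<in>UNIV. interior (phase_box n))"
  proof
    fix x assume "x \<in> S"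
    then obtain n where "x \<in> phase_box n" using assms(2) phase_box_exhausts by blast
    then show "x \<in> (\<Union>n\<in>UNIV. interior (phase_box n))" using phase_box_Suc[of n] by blast
  qed
  then obtain I where I: "finite I" "S \<subseteq> (\<Union>n\<in>I. interior (phase_box n))"
    using compactE_image[OF assms(1), of UNIV "\<lambda>n. interior (phase_box n)"] by auto
  have "interior (phase_box n) \<subseteq> phase_box (Max I)" if "n \<in> I" for n
    using that I(1) phase_box_mono[of n "Max I"] interior_subset[of "phase_box n"] by auto
  with I(2) show ?thesis by blast
qed

text \<open>
  On a compact time interval both solutions stay in one box, where the field is Lipschitz.
\<close>

lemma solutions_agree_forward:
  fixes x y :: "real \<Rightarrow> phase"
  assumes lip: "\<And>n. \<exists>L. L-lipschitz_on (phase_box n) g" and T: "0 \<le> T"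
    and x: "continuous_on {0..T} x" "\<And>t. 0 < t \<Longrightarrow> t < T \<Longrightarrow> (x has_vector_derivative g (x t)) (at t)"
    and y: "continuous_on {0..T} y" "\<And>t. 0 < t \<Longrightarrow> t < T \<Longrightarrow> (y has_vector_derivative g (y t)) (at t)"
    and S: "x ` {0..T} \<subseteq> phase_space" "y ` {0..T} \<subseteq> phase_space"
    and "x 0 = y 0"
  shows "x T = y T"
proof -
  have "compact (x ` {0..T} \<union> y ` {0..T})"
    by (intro compact_Un compact_continuous_image x y) auto
  with S obtain n where n: "x ` {0..T} \<union> y ` {0..T} \<subseteq> phase_box n"
    using compact_subset_phase_box[of "x ` {0..T} \<union> y ` {0..T}"] by auto
  obtain L where "L-lipschitz_on (phase_box n) g" using lip by blast
  from solutions_dist_le[OF this T x y] n have "dist (x T) (y T) \<le> exp (L * T) * dist (x 0) (y 0)"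
    by force
  then show ?thesis using \<open>x 0 = y 0\<close> by simp
qed

lemma mem_einterval_nonneg: "a < 0 \<Longrightarrow> 0 \<le> t \<Longrightarrow> ereal t < b \<Longrightarrow> t \<in> einterval a b"
  by (cases a) (auto simp: einterval_def)

lemma mem_einterval_nonpos: "0 < b \<Longrightarrow> t \<le> 0 \<Longrightarrow> a < ereal t \<Longrightarrow> t \<in> einterval a b"
  by (cases b) (auto simp: einterval_def)

lemma einterval_contains:
  assumes "a < 0" "0 < b" "t \<in> einterval a b"
  shows "{0..t} \<subseteq> einterval a b" "{t..0} \<subseteq> einterval a b"
proof -
  show "{0..t} \<subseteq> einterval a b"
    using assms(1,3) by (cases a; cases b) (auto simp: einterval_def)
  show "{t..0} \<subseteq> einterval a b"
    using assms(2,3) by (cases a; cases b) (auto simp: einterval_def)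
qed

lemma solution_on_continuous:
  assumes "solution_on H a b x" "S \<subseteq> einterval a b"
  shows "continuous_on S x"
proof (rule continuous_at_imp_continuous_on, rule ballI)
  fix t assume "t \<in> S"
  with assms have "(x has_vector_derivative hamiltonian_field H (x t)) (at t)"
    unfolding solution_on_def by blast
  then show "isCont x t" by (rule has_vector_derivative_continuous)
qed

lemma solution_on_unique:
  assumes lip: "\<And>n. \<exists>L. L-lipschitz_on (phase_box n) (hamiltonian_field H)"
    and x: "solution_on H a b x" and y: "solution_on H a' b' y" and eq: "x 0 = y 0"
    and 0: "a < 0" "0 < b" "a' < 0" "0 < b'"
    and t: "t \<in> einterval a b" "t \<in> einterval a' b'"
  shows "x t = y t"
proof (cases "0 \<le> t")
  case True
  have sub: "{0..t} \<subseteq> einterval a b" "{0..t} \<subseteq> einterval a' b'"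
    using einterval_contains 0 t by auto
  show ?thesis
  proof (rule solutions_agree_forward[OF lip True])
    show "continuous_on {0..t} x" "continuous_on {0..t} y"
      by (rule solution_on_continuous[OF x sub(1)] solution_on_continuous[OF y sub(2)])+
    show "(x has_vector_derivative hamiltonian_field H (x s)) (at s)" if "0 < s" "s < t" for s
    proof -
      have "s \<in> einterval a b" using sub(1) that by auto
      with x show ?thesis by (simp add: solution_on_def)
    qed
    show "(y has_vector_derivative hamiltonian_field H (y s)) (at s)" if "0 < s" "s < t" for s
    proof -
      have "s \<in> einterval a' b'" using sub(2) that by auto
      with y show ?thesis by (simp add: solution_on_def)
    qed
  qed (use x y sub eq in \<open>auto simp: solution_on_def\<close>)
next
  case False
  have sub: "{t..0} \<subseteq> einterval a b" "{t..0} \<subseteq> einterval a' b'"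
    using einterval_contains 0 t by auto
  have lip': "\<exists>L. L-lipschitz_on (phase_box n) (\<lambda>v. - hamiltonian_field H v)" for n
    using lip[of n] by (simp)
  have reverse: "((\<lambda>s. w (- s)) has_vector_derivative - hamiltonian_field H (w (- s))) (at s)"
    if "solution_on H c d w" "{t..0} \<subseteq> einterval c d" "0 < s" "s < - t" for w c d s
  proof -
    have "(w has_vector_derivative hamiltonian_field H (w (- s))) (at (- s))"
    proof -
      have "- s \<in> einterval c d" using that(2-4) by auto
      with that(1) show ?thesis by (simp add: solution_on_def)
    qed
    moreover have "((\<lambda>s. - s) has_vector_derivative - 1) (at s)"
      by (auto intro!: derivative_eq_intros)
    ultimately show ?thesis using vector_diff_chain_at[of uminus "- 1" s w] by (simp add: o_def)
  qed
  have "x (- (- t)) = y (- (- t))"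
  proof (rule solutions_agree_forward[OF lip', of "- t" "\<lambda>s. x (- s)" "\<lambda>s. y (- s)"])
    show "continuous_on {0..- t} (\<lambda>s. x (- s))" "continuous_on {0..- t} (\<lambda>s. y (- s))"
      by (rule continuous_on_compose2[OF solution_on_continuous[OF x sub(1)]]
          continuous_on_compose2[OF solution_on_continuous[OF y sub(2)]],
          auto intro!: continuous_intros)+
    have "- s \<in> einterval a b" "- s \<in> einterval a' b'" if "s \<in> {0..- t}" for s
      using sub that by auto
    then show "(\<lambda>s. x (- s)) ` {0..- t} \<subseteq> phase_space" "(\<lambda>s. y (- s)) ` {0..- t} \<subseteq> phase_space"
      using x y unfolding solution_on_def by blast+
  qed (use x y sub eq False in \<open>auto simp: solution_on_def intro!: reverse[OF x] reverse[OF y]\<close>)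
  then show ?thesis by simp
qed

locale locally_lipschitz_hamiltonian =
  fixes H :: "real \<Rightarrow> real \<Rightarrow> real \<Rightarrow> real \<Rightarrow> real"
  assumes field_lipschitz: "\<And>n. \<exists>L. L-lipschitz_on (phase_box n) (hamiltonian_field H)"
begin

text \<open>
  Composition with the retraction onto a box keeps the field on the box and makes it bounded and
  globally Lipschitz, so that its flow is defined for all times.
\<close>

definition truncated_field :: "nat \<Rightarrow> phase \<Rightarrow> phase" where
  "truncated_field n x = hamiltonian_field H
     (let N = real n + 1 in clamp (1/N, -N, -N, -N) (N, N, N, N) x)"

lemma truncated_field_eq: "x \<in> phase_box n \<Longrightarrow> truncated_field n x = hamiltonian_field H x"
  unfolding truncated_field_def phase_box_cbox Let_def by (simp only: clamp_cancel_cbox)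

lemma clamp_phase_box:
  "(let N = real n + 1 in clamp (1/N, -N, -N, -N) (N, N, N, N) x) \<in> phase_box n"
proof -
  have "phase_box n \<noteq> {}" by (auto simp: phase_box_def Let_def field_simps)
  then show ?thesis
    unfolding phase_box_cbox Let_def by (intro clamp_in_interval) (simp only: box_ne_empty)
qed

lemma truncated_field_lipschitz: "\<exists>L. L-lipschitz_on UNIV (truncated_field n)"
proof -
  obtain L where L: "L-lipschitz_on (phase_box n) (hamiltonian_field H)"
    using field_lipschitz by blast
  let ?c = "\<lambda>x. let N = real n + 1 in clamp (1/N, -N, -N, -N) (N, N, N, N) x :: phase"
  have "1-lipschitz_on UNIV ?c"
    by (rule lipschitz_onI) (auto simp: Let_def dist_clamps_le_dist_args)
  then have "(L * 1)-lipschitz_on UNIV (\<lambda>x. hamiltonian_field H (?c x))"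
    by (rule lipschitz_on_compose2) (rule lipschitz_on_subset[OF L], use clamp_phase_box in blast)
  then show ?thesis unfolding truncated_field_def by blast
qed

lemma truncated_field_bounded: "bounded (range (truncated_field n))"
proof -
  have "continuous_on (phase_box n) (hamiltonian_field H)"
    using field_lipschitz lipschitz_on_continuous_on by blast
  then have "bounded (hamiltonian_field H ` phase_box n)"
    using compact_phase_box by (intro compact_imp_bounded compact_continuous_image)
  moreover have "range (truncated_field n) \<subseteq> hamiltonian_field H ` phase_box n"
    unfolding truncated_field_def using clamp_phase_box by blast
  ultimately show ?thesis by (rule bounded_subset)
qed

definition flow :: "nat \<Rightarrow> phase \<Rightarrow> real \<Rightarrow> phase" where
  "flow n x0 = (SOME x. x 0 = x0 \<and> (\<forall>t. (x has_vector_derivative truncated_field n (x t)) (at t)))"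

lemma flow_0 [simp]: "flow n x0 0 = x0"
  and flow_derivative: "(flow n x0 has_vector_derivative truncated_field n (flow n x0 t)) (at t)"
proof -
  obtain L where "L-lipschitz_on UNIV (truncated_field n)" using truncated_field_lipschitz by blast
  from someI_ex[OF ex_global_solution[OF this truncated_field_bounded, of x0], folded flow_def]
  show "flow n x0 0 = x0" "(flow n x0 has_vector_derivative truncated_field n (flow n x0 t)) (at t)"
    by auto
qed

lemma flow_continuous_time: "continuous_on S (flow n x0)"
  using flow_derivative by (meson continuous_at_imp_continuous_on has_vector_derivative_continuous)

lemma flow_continuous_initial:
  assumes "0 \<le> t" shows "continuous_on UNIV (\<lambda>x. flow n x t)"
proof -
  obtain L where L: "L-lipschitz_on UNIV (truncated_field n)" using truncated_field_lipschitz by blast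
  have "(exp (L * t))-lipschitz_on UNIV (\<lambda>x. flow n x t)"
  proof (rule lipschitz_onI)
    fix x y
    have "dist (flow n x t) (flow n y t) \<le> exp (L * t) * dist (flow n x 0) (flow n y 0)"
      by (rule solutions_dist_le[OF L assms]) (auto intro: flow_continuous_time flow_derivative)
    then show "dist (flow n x t) (flow n y t) \<le> exp (L * t) * dist x y" by simp
  qed simp
  then show ?thesis by (rule lipschitz_on_continuous_on)
qed

lemma flow_unique:
  assumes "0 \<le> t" and x: "continuous_on {0..t} x"
    "\<And>s. 0 < s \<Longrightarrow> s < t \<Longrightarrow> (x has_vector_derivative hamiltonian_field H (x s)) (at s)"
    "\<And>s. 0 < s \<Longrightarrow> s < t \<Longrightarrow> x s \<in> phase_box n"
  shows "flow n (x 0) t = x t"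
proof -
  obtain L where L: "L-lipschitz_on UNIV (truncated_field n)" using truncated_field_lipschitz by blast
  have "dist (flow n (x 0) t) (x t) \<le> exp (L * t) * dist (flow n (x 0) 0) (x 0)"
    by (rule solutions_dist_le[OF L assms(1) flow_continuous_time flow_derivative x(1)])
      (use x in \<open>auto simp: truncated_field_eq\<close>)
  then show ?thesis by simp
qed

text \<open>
  As long as it stays in the box, a trajectory of the truncated flow is a solution of the original
  equation.
\<close>

definition stays :: "nat \<Rightarrow> real \<Rightarrow> phase \<Rightarrow> bool" where
  "stays n t x0 \<longleftrightarrow> (\<forall>s\<in>{0..t}. flow n x0 s \<in> phase_box n)"

definition solutions_from :: "phase \<Rightarrow> (ereal \<times> ereal \<times> (real \<Rightarrow> phase)) set" where
  "solutions_from x0 = {(a, b, y). a < 0 \<and> 0 < b \<and> solution_on H a b y \<and> y 0 = x0}"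

text \<open>
  The maximal solution through \<open>x0\<close> is the union of all solutions through \<open>x0\<close>. Uniqueness
  makes it well defined, and its maximality is then immediate.
\<close>

definition start_time :: "phase \<Rightarrow> ereal" where
  "start_time x0 = Inf {a. \<exists>b y. (a, b, y) \<in> solutions_from x0}"

definition end_time :: "phase \<Rightarrow> ereal" where
  "end_time x0 = Sup {b. \<exists>a y. (a, b, y) \<in> solutions_from x0}"

definition trajectory :: "phase \<Rightarrow> real \<Rightarrow> phase" where
  "trajectory x0 t = (SOME v. \<exists>a b y. (a, b, y) \<in> solutions_from x0 \<and> t \<in> einterval a b \<and> y t = v)"

lemma solutions_from_bounds:
  assumes "(a, b, y) \<in> solutions_from x0"
  shows "start_time x0 \<le> a" "b \<le> end_time x0"
  using assms unfolding start_time_def end_time_def by (auto intro: Inf_lower Sup_upper)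

lemma trajectory_eq:
  assumes y: "(a, b, y) \<in> solutions_from x0" and t: "t \<in> einterval a b"
  shows "trajectory x0 t = y t"
  unfolding trajectory_def
proof (rule some_equality)
  fix v assume "\<exists>a b y. (a, b, y) \<in> solutions_from x0 \<and> t \<in> einterval a b \<and> y t = v"
  then obtain a' b' y' where y': "(a', b', y') \<in> solutions_from x0" and t': "t \<in> einterval a' b'" "y' t = v"
    by blast
  have "y' t = y t"
    by (rule solution_on_unique[OF field_lipschitz, of a' b' y' a b])
      (use y y' t t' in \<open>auto simp: solutions_from_def\<close>)
  then show "v = y t" using t' by simp
qed (use assms in blast)

text \<open>
  The box is closed, and its points are interior to the next box. So the flow of the next truncation
  still solves the original equation slightly beyond \<open>t\<close>, and slightly before time \<open>0\<close>.
\<close>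

lemma stays_extends:
  assumes "0 \<le> t" "stays n t x0"
  shows "\<exists>e>0. (ereal (- e), ereal (t + e), flow (Suc n) x0) \<in> solutions_from x0"
proof -
  let ?y = "flow (Suc n) x0" let ?K = "interior (phase_box (Suc n))"
  have same: "flow (Suc n) x0 s = flow n x0 s" if "s \<in> {0..t}" for s
  proof -
    have "flow (Suc n) (flow n x0 0) s = flow n x0 s"
    proof (rule flow_unique)
      fix r assume r: "0 < r" "r < s"
      then have *: "flow n x0 r \<in> phase_box n" using assms that by (auto simp: stays_def)
      then show "flow n x0 r \<in> phase_box (Suc n)" using phase_box_mono[of n "Suc n"] by auto
      show "(flow n x0 has_vector_derivative hamiltonian_field H (flow n x0 r)) (at r)"
        using flow_derivative[of n x0 r] truncated_field_eq[OF *] by simp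
    qed (use that flow_continuous_time in auto)
    then show ?thesis by simp
  qed
  have K: "?y s \<in> ?K" if "s \<in> {0..t}" for s
    using same[OF that] assms(2) that phase_box_Suc[of n] by (auto simp: stays_def)
  have op: "open (?y -` ?K)"
    using flow_continuous_time by (intro open_vimage) auto
  have "0 \<in> ?y -` ?K" "t \<in> ?y -` ?K" using K[of 0] K[of t] assms(1) by auto
  then obtain e1 e2 where e: "e1 > 0" "ball 0 e1 \<subseteq> ?y -` ?K" "e2 > 0" "ball t e2 \<subseteq> ?y -` ?K"
    using op open_contains_ball by meson
  define e where "e = min e1 e2"
  have inK: "?y s \<in> ?K" if "- e < s" "s < t + e" for s
  proof -
    have "- e1 < s" "s < t + e2" using that unfolding e_def by linarith+
    then consider "s \<in> {0..t}" | "s \<in> ball 0 e1" | "s \<in> ball t e2"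
      by (cases "s < 0"; cases "s > t") (auto simp: dist_real_def)
    then show ?thesis using K e by cases auto
  qed
  have "solution_on H (- e) (t + e) ?y"
    unfolding solution_on_def
  proof
    fix s assume "s \<in> einterval (- e) (t + e)"
    then have *: "?y s \<in> phase_box (Suc n)" using inK[of s] interior_subset by (auto simp: einterval_def)
    then show "?y s \<in> phase_space \<and> (?y has_vector_derivative hamiltonian_field H (?y s)) (at s)"
      using flow_derivative[of "Suc n" x0 s] truncated_field_eq[OF *] subsetD[OF phase_box_subset *] by simp
  qed
  with e assms(1) show ?thesis
    by (intro exI[of _ e]) (auto simp: e_def solutions_from_def)
qed

context
  fixes x0 assumes x0: "x0 \<in> phase_space"
begin

lemma start_end_time: "start_time x0 < 0" "0 < end_time x0"
proof -
  obtain n where "x0 \<in> phase_box n" using x0 phase_box_exhausts by blast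
  then have "stays n 0 x0" by (simp add: stays_def)
  from stays_extends[OF _ this] obtain e where e: "e > 0"
    and "(ereal (- e), ereal (0 + e), flow (Suc n) x0) \<in> solutions_from x0" by auto
  note b = solutions_from_bounds[OF this(2)]
  show "start_time x0 < 0" by (rule le_less_trans[OF b(1)]) (use e in auto)
  show "0 < end_time x0" by (rule less_le_trans[OF _ b(2)]) (use e in auto)
qed

lemma ex_solution_through:
  assumes "t \<in> einterval (start_time x0) (end_time x0)"
  obtains a b y where "(a, b, y) \<in> solutions_from x0" "t \<in> einterval a b"
proof (cases "0 \<le> t")
  case True
  from assms obtain a b y where y: "(a, b, y) \<in> solutions_from x0" "ereal t < b"
    unfolding einterval_def end_time_def less_Sup_iff by auto
  then have "t \<in> einterval a b" using True by (auto simp: solutions_from_def intro: mem_einterval_nonneg)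
  with y that show ?thesis by blast
next
  case False
  from assms obtain a b y where y: "(a, b, y) \<in> solutions_from x0" "a < ereal t"
    unfolding einterval_def start_time_def Inf_less_iff by auto
  then have "t \<in> einterval a b" using False by (auto simp: solutions_from_def intro: mem_einterval_nonpos)
  with y that show ?thesis by blast
qed

lemma trajectory_solution: "solution_on H (start_time x0) (end_time x0) (trajectory x0)"
  unfolding solution_on_def
proof
  fix t assume "t \<in> einterval (start_time x0) (end_time x0)"
  then obtain a b y where y: "(a, b, y) \<in> solutions_from x0" "t \<in> einterval a b"
    by (rule ex_solution_through)
  then have s: "y t \<in> phase_space" "(y has_vector_derivative hamiltonian_field H (y t)) (at t)"
    by (auto simp: solutions_from_def solution_on_def)
  have "(trajectory x0 has_vector_derivative hamiltonian_field H (y t)) (at t)"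
    by (rule has_vector_derivative_transform_within_open[OF s(2) open_einterval y(2)])
      (simp add: trajectory_eq[OF y(1)])
  then show "trajectory x0 t \<in> phase_space \<and>
      (trajectory x0 has_vector_derivative hamiltonian_field H (trajectory x0 t)) (at t)"
    using s trajectory_eq[OF y] by simp
qed

lemma trajectory_0: "trajectory x0 0 = x0"
proof -
  have "0 \<in> einterval (start_time x0) (end_time x0)"
    using start_end_time by (simp add: einterval_def zero_ereal_def[symmetric])
  then obtain a b y where y: "(a, b, y) \<in> solutions_from x0" "0 \<in> einterval a b"
    by (rule ex_solution_through)
  from trajectory_eq[OF this] y(1) show ?thesis by (simp add: solutions_from_def)
qed

lemma trajectory_maximal: "maximal_solution H (start_time x0) (end_time x0) (trajectory x0)"
  unfolding maximal_solution_def
proof (intro conjI trajectory_solution allI impI)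
  fix a' b' y
  assume *: "a' \<le> start_time x0 \<and> end_time x0 \<le> b' \<and> solution_on H a' b' y
    \<and> (\<forall>t\<in>einterval (start_time x0) (end_time x0). y t = trajectory x0 t)"
  moreover have "0 \<in> einterval (start_time x0) (end_time x0)"
    using start_end_time by (simp add: einterval_def zero_ereal_def[symmetric])
  ultimately have "(a', b', y) \<in> solutions_from x0"
    using start_end_time trajectory_0
    by (auto simp: solutions_from_def intro: le_less_trans less_le_trans)
  from solutions_from_bounds[OF this] * show "a' = start_time x0" "b' = end_time x0" by auto
qed

lemma maximal_solution_unique:
  assumes x: "maximal_solution H a b x" "a < 0" "0 < b" "x 0 = x0"
  shows "b = end_time x0" "\<And>t. t \<in> einterval a b \<Longrightarrow> x t = trajectory x0 t"
proof -
  have s: "(a, b, x) \<in> solutions_from x0"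
    using x by (auto simp: solutions_from_def maximal_solution_def)
  show eq: "\<And>t. t \<in> einterval a b \<Longrightarrow> x t = trajectory x0 t" using trajectory_eq[OF s] by simp
  show "b = end_time x0"
    using x(1) solutions_from_bounds[OF s] trajectory_solution eq unfolding maximal_solution_def by metis
qed

lemma stays_before_end: "0 \<le> t \<Longrightarrow> stays n t x0 \<Longrightarrow> ereal t < end_time x0"
  using stays_extends[of t n x0] solutions_from_bounds(2)
  by (metis ereal_less(2) less_add_same_cancel1 less_ereal.simps(1) less_le_trans)

lemma flow_eq_trajectory:
  assumes "0 \<le> t" "ereal t < end_time x0" "\<And>s. 0 < s \<Longrightarrow> s < t \<Longrightarrow> trajectory x0 s \<in> phase_box n"
  shows "flow n x0 t = trajectory x0 t"
proof -
  have sub: "{0..t} \<subseteq> einterval (start_time x0) (end_time x0)"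
    using start_end_time assms by (intro einterval_contains mem_einterval_nonneg)
  have "flow n (trajectory x0 0) t = trajectory x0 t"
  proof (rule flow_unique)
    fix s assume s: "0 < s" "s < t"
    then have "s \<in> einterval (start_time x0) (end_time x0)" using sub by auto
    then show "(trajectory x0 has_vector_derivative hamiltonian_field H (trajectory x0 s)) (at s)"
      using trajectory_solution by (simp add: solution_on_def)
    show "trajectory x0 s \<in> phase_box n" using s by (rule assms(3))
  qed (use assms(1) solution_on_continuous[OF trajectory_solution sub] in auto)
  then show ?thesis by (simp add: trajectory_0)
qed

lemma stays_flow_eq_trajectory:
  assumes "0 \<le> s" "s \<le> t" "stays n t x0"
  shows "flow n x0 s = trajectory x0 s"
proof -
  from stays_extends[OF _ assms(3)] assms obtain e where e: "e > 0"
    "(ereal (- e), ereal (t + e), flow (Suc n) x0) \<in> solutions_from x0" by auto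
  have "flow n x0 s = flow (Suc n) x0 s"
  proof -
    have "flow (Suc n) (flow n x0 0) s = flow n x0 s"
    proof (rule flow_unique)
      fix r assume r: "0 < r" "r < s"
      then have *: "flow n x0 r \<in> phase_box n" using assms by (auto simp: stays_def)
      then show "flow n x0 r \<in> phase_box (Suc n)" using phase_box_mono[of n "Suc n"] by auto
      show "(flow n x0 has_vector_derivative hamiltonian_field H (flow n x0 r)) (at r)"
        using flow_derivative[of n x0 r] truncated_field_eq[OF *] by simp
    qed (use assms flow_continuous_time in auto)
    then show ?thesis by simp
  qed
  also have "\<dots> = trajectory x0 s"
    using trajectory_eq[OF e(2), of s] assms e(1) by (auto simp: einterval_def)
  finally show ?thesis .
qed

lemma ex_stays:
  assumes "0 \<le> t" "ereal t < end_time x0"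
  shows "\<exists>n. stays n t x0"
proof -
  have sub: "{0..t} \<subseteq> einterval (start_time x0) (end_time x0)"
    using start_end_time assms by (intro einterval_contains mem_einterval_nonneg)
  have "compact (trajectory x0 ` {0..t})"
    using solution_on_continuous[OF trajectory_solution sub] by (intro compact_continuous_image) auto
  moreover have "trajectory x0 ` {0..t} \<subseteq> phase_space"
    using sub trajectory_solution by (auto simp: solution_on_def)
  ultimately obtain n where n: "trajectory x0 ` {0..t} \<subseteq> phase_box n"
    using compact_subset_phase_box by blast
  have "flow n x0 s = trajectory x0 s" if "s \<in> {0..t}" for s
    using that n assms
    by (intro flow_eq_trajectory) (auto intro: le_less_trans[of _ "ereal t"])
  then show ?thesis using n by (auto simp: stays_def image_subset_iff intro!: exI[of _ n])
qed

text \<open>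
  A maximal solution that ends in finite time leaves every compact set: if it stayed in a box, so
  would the truncated flow on the closed time interval, and \<open>stays_extends\<close> would prolong the solution.
\<close>

lemma not_confined_to_phase_box:
  assumes "end_time x0 = ereal B"
  shows "\<exists>t. 0 \<le> t \<and> t < B \<and> trajectory x0 t \<notin> phase_box n"
proof (rule ccontr)
  assume "\<not> ?thesis"
  then have inK: "trajectory x0 t \<in> phase_box n" if "0 \<le> t" "t < B" for t using that by auto
  have B: "0 < B" using start_end_time(2) assms by simp
  have K: "flow n x0 t \<in> phase_box n" if "t \<in> {0..<B}" for t
    using flow_eq_trajectory[of t n] inK that assms by auto
  have "flow n x0 ` closure {0..<B} \<subseteq> phase_box n"
    by (rule image_closure_subset[OF flow_continuous_time closed_phase_box]) (use K in auto)
  then have "stays n B x0" using B by (auto simp: stays_def)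
  from stays_before_end[OF _ this] B assms show False by simp
qed

text \<open>
  The limit at the possibly infinite end time, expressed by real times.
\<close>

lemma leads_to_triple_collision_iff_trajectory:
  "leads_to_triple_collision H x0 \<longleftrightarrow>
   (\<forall>e>0. \<exists>q\<ge>0. ereal q < end_time x0 \<and>
      (\<forall>t\<ge>q. ereal t < end_time x0 \<longrightarrow> norm (fst (trajectory x0 t), fst (snd (trajectory x0 t))) \<le> e))"
  (is "_ \<longleftrightarrow> ?R")
proof -
  define pos where "pos x = (fst x, fst (snd x))" for x :: phase
  have lim: "(((\<lambda>t. pos (x t)) \<circ> real_of_ereal) \<longlongrightarrow> (0, 0)) (at_left b) \<longleftrightarrow>
      (\<forall>e>0. \<exists>q\<ge>0. ereal q < b \<and> (\<forall>t\<ge>q. ereal t < b \<longrightarrow> norm (pos (x t)) \<le> e))"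
    (is "?L \<longleftrightarrow> ?Q") if b: "0 < b" for x b
  proof
    assume ?L
    show ?Q
    proof (intro allI impI)
      fix e :: real assume "e > 0"
      with \<open>?L\<close> have "eventually (\<lambda>t. dist (((\<lambda>t. pos (x t)) \<circ> real_of_ereal) t) (0, 0) < e) (at_left b)"
        by (rule tendstoD)
      then obtain c where c: "c < b" "\<And>t. c < t \<Longrightarrow> t < b \<Longrightarrow> norm (pos (x (real_of_ereal t))) < e"
        unfolding eventually_at_left[OF b] by (auto simp: dist_norm zero_prod_def[symmetric])
      from c(1) b have "max c 0 < b" by simp
      then obtain q where q: "max c 0 < ereal q" "ereal q < b" using ereal_dense2 by blast
      have "norm (pos (x t)) \<le> e" if "t \<ge> q" "ereal t < b" for t
      proof -
        have "c < ereal t" using q(1) that(1) by (cases c) auto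
        from c(2)[OF this that(2)] show ?thesis by simp
      qed
      with q show "\<exists>q\<ge>0. ereal q < b \<and> (\<forall>t\<ge>q. ereal t < b \<longrightarrow> norm (pos (x t)) \<le> e)"
        by (intro exI[of _ q]) auto
    qed
  next
    assume Q: ?Q
    show ?L
    proof (rule tendstoI)
      fix e :: real assume "e > 0"
      then obtain q where q: "q \<ge> 0" "ereal q < b" "\<And>t. t \<ge> q \<Longrightarrow> ereal t < b \<Longrightarrow> norm (pos (x t)) \<le> e / 2"
        using Q half_gt_zero by metis
      show "eventually (\<lambda>t. dist (((\<lambda>t. pos (x t)) \<circ> real_of_ereal) t) (0, 0) < e) (at_left b)"
        unfolding eventually_at_left[OF b]
      proof (intro exI[of _ "ereal q"] conjI allI impI q)
        fix t assume t: "ereal q < t" "t < b"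
        then obtain r where r: "t = ereal r" by (cases t) auto
        with q(3)[of r] t \<open>e > 0\<close>
        show "dist (((\<lambda>t. pos (x t)) \<circ> real_of_ereal) t) (0, 0) < e"
          by (simp add: dist_norm zero_prod_def[symmetric])
      qed
    qed
  qed
  show ?thesis
  proof
    assume "leads_to_triple_collision H x0"
    then obtain a b x where ab: "a < 0" "0 < b" and x: "maximal_solution H a b x" "x 0 = x0"
      and L: "(((\<lambda>t. pos (x t)) \<circ> real_of_ereal) \<longlongrightarrow> (0, 0)) (at_left b)"
      unfolding leads_to_triple_collision_def pos_def by blast
    note u = maximal_solution_unique[OF x(1) ab x(2)]
    have eq: "x t = trajectory x0 t" if "0 \<le> t" "ereal t < b" for t
      using u(2)[of t] that ab(1) by (auto intro: mem_einterval_nonneg)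
    show ?R
    proof (intro allI impI)
      fix e :: real assume "e > 0"
      with L obtain q where q: "q \<ge> 0" "ereal q < b"
        "\<And>t. t \<ge> q \<Longrightarrow> ereal t < b \<Longrightarrow> norm (pos (x t)) \<le> e"
        unfolding lim[OF ab(2)] by blast
      have "norm (pos (trajectory x0 t)) \<le> e" if "t \<ge> q" "ereal t < end_time x0" for t
        using q(3)[of t] eq[of t] q(1) that u(1) by simp
      with q(1,2) show "\<exists>q\<ge>0. ereal q < end_time x0 \<and> (\<forall>t\<ge>q. ereal t < end_time x0 \<longrightarrow>
          norm (fst (trajectory x0 t), fst (snd (trajectory x0 t))) \<le> e)"
        unfolding u(1) pos_def by blast
    qed
  next
    assume ?R
    then have "(((\<lambda>t. pos (trajectory x0 t)) \<circ> real_of_ereal) \<longlongrightarrow> (0, 0)) (at_left (end_time x0))"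
      unfolding lim[OF start_end_time(2)] unfolding pos_def .
    with start_end_time trajectory_maximal trajectory_0
    show "leads_to_triple_collision H x0"
      unfolding leads_to_triple_collision_def pos_def by blast
  qed
qed

end

definition stays_near :: "nat \<Rightarrow> real \<Rightarrow> real \<Rightarrow> real \<Rightarrow> phase \<Rightarrow> bool" where
  "stays_near n e q t x0 \<longleftrightarrow> (\<forall>s\<in>{q..t}. norm (fst (flow n x0 s), fst (snd (flow n x0 s))) \<le> e)"

text \<open>
  The end time and the maximal solution have disappeared from the right-hand side: a time \<open>q\<close> is before
  the end exactly if some truncated flow stays in its box up to \<open>q\<close>. All quantifiers range over
  countable types, and each condition on \<open>x0\<close> is a Boolean combination of closed ones.
\<close>

lemma leads_to_triple_collision_iff_flow:
  "leads_to_triple_collision H x0 \<longleftrightarrow>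
   (\<forall>k::nat. \<exists>q::rat. 0 \<le> q \<and> (\<exists>n. stays n (of_rat q) x0) \<and>
      (\<forall>n. \<forall>t::rat. stays n (of_rat t) x0 \<longrightarrow> stays_near n (1 / Suc k) (of_rat q) (of_rat t) x0))"
  (is "_ \<longleftrightarrow> ?R")
proof (cases "x0 \<in> phase_space")
  case False
  have "\<not> leads_to_triple_collision H x0"
    using False by (auto simp: leads_to_triple_collision_def maximal_solution_def solution_on_def
        einterval_def zero_ereal_def[symmetric])
  moreover have "\<not> stays n (of_rat q) x0" if "0 \<le> q" for n and q :: rat
    using False that phase_box_subset[of n] by (auto simp: stays_def intro!: bexI[of _ 0])
  ultimately show ?thesis by blast
next
  case True
  note stays_eq = stays_flow_eq_trajectory[OF True]
  show ?thesis
    unfolding leads_to_triple_collision_iff_trajectory[OF True]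
  proof (intro iffI allI impI)
    fix k :: nat
    assume "\<forall>e>0. \<exists>q\<ge>0. ereal q < end_time x0 \<and>
      (\<forall>t\<ge>q. ereal t < end_time x0 \<longrightarrow> norm (fst (trajectory x0 t), fst (snd (trajectory x0 t))) \<le> e)"
    moreover have "1 / real (Suc k) > 0" by simp
    ultimately obtain q where q: "q \<ge> 0" "ereal q < end_time x0"
      "\<And>t. t \<ge> q \<Longrightarrow> ereal t < end_time x0 \<Longrightarrow>
        norm (fst (trajectory x0 t), fst (snd (trajectory x0 t))) \<le> 1 / Suc k" by blast
    from q(2) obtain r where r: "ereal q < ereal r" "ereal r < end_time x0" using ereal_dense2 by blast
    from r(1) obtain p where p: "q < of_rat p" "of_rat p < r" using of_rat_dense[of q r] by auto
    have p0: "0 \<le> real_of_rat p" using p q(1) by linarith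
    have "ereal (of_rat p) < end_time x0" using p r by (auto intro: less_trans[of _ "ereal r"])
    with ex_stays[OF True p0] obtain n where n: "stays n (of_rat p) x0" by blast
    have "stays_near m (1 / Suc k) (of_rat p) (of_rat t) x0" if "stays m (of_rat t) x0" for m and t :: rat
      unfolding stays_near_def
    proof
      fix s assume s: "s \<in> {real_of_rat p..real_of_rat t}"
      then have s': "0 \<le> s" "s \<le> real_of_rat t" "q \<le> s"
        using p0 p(1) unfolding atLeastAtMost_iff by linarith+
      have "stays m s x0" using that s' by (auto simp: stays_def)
      from q(3)[OF s'(3) stays_before_end[OF True s'(1) this]]
      show "norm (fst (flow m x0 s), fst (snd (flow m x0 s))) \<le> 1 / Suc k"
        using stays_eq[OF s'(1,2) that] by simp
    qed
    then show "\<exists>q::rat. 0 \<le> q \<and> (\<exists>n. stays n (of_rat q) x0) \<and>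
      (\<forall>n. \<forall>t::rat. stays n (of_rat t) x0 \<longrightarrow> stays_near n (1 / Suc k) (of_rat q) (of_rat t) x0)"
      using n p0 by (intro exI[of _ p]) auto
  next
    fix e :: real assume R: ?R and "e > 0"
    then obtain k where k: "inverse (Suc k) < e" using reals_Archimedean by blast
    from R obtain q :: rat and n where q: "0 \<le> q" "stays n (of_rat q) x0"
      and near: "\<And>n t. stays n (of_rat t) x0 \<Longrightarrow> stays_near n (1 / Suc k) (of_rat q) (of_rat t) x0"
      by blast
    have q0: "0 \<le> real_of_rat q" using q by simp
    have "norm (fst (trajectory x0 t), fst (snd (trajectory x0 t))) \<le> e"
      if t: "real_of_rat q \<le> t" "ereal t < end_time x0" for t
    proof -
      obtain r where r: "ereal t < ereal r" "ereal r < end_time x0" using t ereal_dense2 by blast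
      \<comment> \<open>a box that confines the flow up to a rational time beyond \<open>t\<close>\<close>
      from r(1) obtain p where p: "t < of_rat p" "of_rat p < r" using of_rat_dense[of t r] by auto
      have "0 \<le> real_of_rat p" using p(1) q0 t(1) by linarith
      moreover have "ereal (of_rat p) < end_time x0"
        using p r by (auto intro: less_trans[of _ "ereal r"])
      ultimately obtain m where m: "stays m (of_rat p) x0"
        using ex_stays[OF True] by blast
      from near[OF m] t(1) p(1)
      have "norm (fst (flow m x0 t), fst (snd (flow m x0 t))) \<le> 1 / Suc k"
        unfolding stays_near_def by auto
      with stays_eq[OF _ _ m, of t] p(1) t(1) q0 k show ?thesis by (simp add: inverse_eq_divide)
    qed
    with q0 stays_before_end[OF True q0 q(2)]
    show "\<exists>q\<ge>0. ereal q < end_time x0 \<and>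
      (\<forall>t\<ge>q. ereal t < end_time x0 \<longrightarrow> norm (fst (trajectory x0 t), fst (snd (trajectory x0 t))) \<le> e)"
      by (intro exI[of _ "real_of_rat q"]) auto
  qed
qed

lemma closed_stays: "closed {x. stays n t x}"
proof -
  have "{x. stays n t x} = (\<Inter>s\<in>{0..t}. (\<lambda>x. flow n x s) -` phase_box n)"
    by (auto simp: stays_def)
  also have "closed \<dots>"
    by (intro closed_INT ballI closed_vimage closed_phase_box flow_continuous_initial) auto
  finally show ?thesis .
qed

lemma closed_stays_near:
  assumes "0 \<le> q" shows "closed {x. stays_near n e q t x}"
proof -
  have "{x. stays_near n e q t x} =
      (\<Inter>s\<in>{q..t}. {x. norm (fst (flow n x s), fst (snd (flow n x s))) \<le> e})"
    by (auto simp: stays_near_def)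
  also have "closed \<dots>"
    using assms
    by (intro closed_INT ballI closed_Collect_le continuous_intros flow_continuous_initial) auto
  finally show ?thesis .
qed

lemma borel_leads_to_triple_collision: "{x. leads_to_triple_collision H x} \<in> sets borel"
proof -
  have [measurable]: "Measurable.pred borel (stays n t)" for n t
    using borel_closed[OF closed_stays] by (simp add: pred_def)
  have near: "Measurable.pred borel (\<lambda>x. stays_near n e (of_rat q) t x)" if "0 \<le> q" for n e t and q :: rat
    using borel_closed[OF closed_stays_near] that by (simp add: pred_def)
  have [measurable]: "Measurable.pred borel (\<lambda>x. 0 \<le> q \<and> stays_near n e (of_rat q) t x)"
    for n e t and q :: rat using near by (cases "0 \<le> q") auto
  have "leads_to_triple_collision H = (\<lambda>x.
     \<forall>k::nat. \<exists>q::rat. 0 \<le> q \<and> (\<exists>n. stays n (of_rat q) x) \<and>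
      (\<forall>n. \<forall>t::rat. stays n (of_rat t) x \<longrightarrow> 0 \<le> q \<and> stays_near n (1 / Suc k) (of_rat q) (of_rat t) x))"
    by (rule ext) (subst leads_to_triple_collision_iff_flow, blast)
  also have "Measurable.pred borel \<dots>" by measurable
  finally show ?thesis by (simp add: pred_def)
qed

end

section \<open>The vector field of the isosceles problem\<close>

text \<open>
  Boundedness is included because it makes the class closed under products.
\<close>

definition bounded_lipschitz_on :: "'a::metric_space set \<Rightarrow> ('a \<Rightarrow> real) \<Rightarrow> bool" where
  "bounded_lipschitz_on S f \<longleftrightarrow> (\<exists>K. \<forall>x\<in>S. \<bar>f x\<bar> \<le> K) \<and> (\<exists>L. L-lipschitz_on S f)"

lemma bounded_lipschitz_onI:
  "(\<And>x. x \<in> S \<Longrightarrow> \<bar>f x\<bar> \<le> K) \<Longrightarrow> L-lipschitz_on S f \<Longrightarrow> bounded_lipschitz_on S f"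
  unfolding bounded_lipschitz_on_def by blast

lemma bounded_lipschitz_on_const [intro]: "bounded_lipschitz_on S (\<lambda>_. c)"
  by (rule bounded_lipschitz_onI[of _ _ "\<bar>c\<bar>" 0]) (auto intro: lipschitz_intros)

lemma bounded_lipschitz_on_add [intro]:
  assumes "bounded_lipschitz_on S f" "bounded_lipschitz_on S g"
  shows "bounded_lipschitz_on S (\<lambda>x. f x + g x)"
proof -
  from assms obtain K L K' L' where "\<And>x. x \<in> S \<Longrightarrow> \<bar>f x\<bar> \<le> K" "L-lipschitz_on S f"
    "\<And>x. x \<in> S \<Longrightarrow> \<bar>g x\<bar> \<le> K'" "L'-lipschitz_on S g"
    unfolding bounded_lipschitz_on_def by blast
  then show ?thesis
    by (intro bounded_lipschitz_onI[of _ _ "K + K'" "L + L'"] lipschitz_on_add)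
      (auto intro: order_trans[OF abs_triangle_ineq] add_mono)
qed

lemma bounded_lipschitz_on_mult [intro]:
  assumes "bounded_lipschitz_on S f" "bounded_lipschitz_on S g"
  shows "bounded_lipschitz_on S (\<lambda>x. f x * g x)"
proof -
  from assms obtain K L K' L' where f: "\<And>x. x \<in> S \<Longrightarrow> \<bar>f x\<bar> \<le> K" "L-lipschitz_on S f"
    and g: "\<And>x. x \<in> S \<Longrightarrow> \<bar>g x\<bar> \<le> K'" "L'-lipschitz_on S g"
    unfolding bounded_lipschitz_on_def by blast
  show ?thesis
  proof (rule bounded_lipschitz_onI)
    fix x assume x: "x \<in> S"
    show "\<bar>f x * g x\<bar> \<le> \<bar>K\<bar> * \<bar>K'\<bar>"
      unfolding abs_mult using f(1)[OF x] g(1)[OF x] by (intro mult_mono) auto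
  next
    show "(\<bar>K\<bar> * L' + \<bar>K'\<bar> * L)-lipschitz_on S (\<lambda>x. f x * g x)"
    proof (rule lipschitz_onI)
      fix x y assume xy: "x \<in> S" "y \<in> S"
      have "dist (f x * g x) (f y * g y) = \<bar>f x * (g x - g y) + g y * (f x - f y)\<bar>"
        by (simp add: dist_real_def algebra_simps)
      also have "\<dots> \<le> \<bar>f x\<bar> * \<bar>g x - g y\<bar> + \<bar>g y\<bar> * \<bar>f x - f y\<bar>"
        by (metis abs_mult abs_triangle_ineq)
      also have "\<dots> \<le> \<bar>K\<bar> * (L' * dist x y) + \<bar>K'\<bar> * (L * dist x y)"
        using f(1)[OF xy(1)] g(1)[OF xy(2)] lipschitz_onD[OF f(2) xy] lipschitz_onD[OF g(2) xy]
        by (intro add_mono mult_mono) (auto simp: dist_real_def)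
      finally show "dist (f x * g x) (f y * g y) \<le> (\<bar>K\<bar> * L' + \<bar>K'\<bar> * L) * dist x y"
        by (simp add: algebra_simps)
    qed (use lipschitz_on_nonneg[OF f(2)] lipschitz_on_nonneg[OF g(2)] in simp)
  qed
qed

lemma bounded_lipschitz_on_power [intro]:
  "bounded_lipschitz_on S f \<Longrightarrow> bounded_lipschitz_on S (\<lambda>x. f x ^ n)"
  by (induction n) auto

lemma bounded_lipschitz_on_inverse:
  assumes f: "bounded_lipschitz_on S f" and c: "0 < c" "\<And>x. x \<in> S \<Longrightarrow> c \<le> f x"
  shows "bounded_lipschitz_on S (\<lambda>x. inverse (f x))"
proof -
  from f obtain L where L: "L-lipschitz_on S f" unfolding bounded_lipschitz_on_def by blast
  show ?thesis
  proof (rule bounded_lipschitz_onI)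
    fix x assume x: "x \<in> S"
    show "\<bar>inverse (f x)\<bar> \<le> inverse c" using c(2)[OF x] c(1) by (simp add: le_imp_inverse_le)
  next
    show "(inverse c * inverse c * L)-lipschitz_on S (\<lambda>x. inverse (f x))"
    proof (rule lipschitz_onI)
      fix x y assume xy: "x \<in> S" "y \<in> S"
      have pos: "0 < f x" "0 < f y" using c(1) c(2)[OF xy(1)] c(2)[OF xy(2)] by auto
      have "dist (inverse (f x)) (inverse (f y)) = inverse (f x) * inverse (f y) * dist (f x) (f y)"
        using pos by (auto simp: dist_real_def field_simps abs_if)
      also have "\<dots> \<le> inverse c * inverse c * (L * dist x y)"
        using c(1) c(2)[OF xy(1)] c(2)[OF xy(2)] pos lipschitz_onD[OF L xy]
        by (intro mult_mono) (auto intro: le_imp_inverse_le)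
      finally show "dist (inverse (f x)) (inverse (f y)) \<le> inverse c * inverse c * L * dist x y"
        by (simp add: mult_ac)
    qed (use c(1) lipschitz_on_nonneg[OF L] in simp)
  qed
qed

lemma bounded_lipschitz_on_Pair:
  assumes "bounded_lipschitz_on S f" "\<exists>L. L-lipschitz_on S g"
  shows "\<exists>L. L-lipschitz_on S (\<lambda>x. (f x, g x))"
  using assms lipschitz_on_Pair unfolding bounded_lipschitz_on_def by blast

text \<open>
  Twice the distance between the third body and either of the equal masses.
\<close>

definition arm :: "real \<Rightarrow> real \<Rightarrow> real" where
  "arm R z = sqrt (R\<^sup>2 + 4 * z\<^sup>2)"

lemma arm_ge: "0 < R \<Longrightarrow> R \<le> arm R z"
  unfolding arm_def by (rule real_le_rsqrt) simp

lemma arm_pos: "0 < R \<Longrightarrow> 0 < arm R z"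
  using arm_ge[of R z] by simp

lemma arm_powr:
  "(R\<^sup>2 + 4 * z\<^sup>2) powr (1/2) = arm R z" "(R\<^sup>2 + 4 * z\<^sup>2) powr (3/2) = arm R z ^ 3"
proof -
  have nn: "0 \<le> R\<^sup>2 + 4 * z\<^sup>2" by simp
  then show 1: "(R\<^sup>2 + 4 * z\<^sup>2) powr (1/2) = arm R z" unfolding arm_def by (rule powr_half_sqrt)
  have "(R\<^sup>2 + 4 * z\<^sup>2) powr (3/2) = ((R\<^sup>2 + 4 * z\<^sup>2) powr (1/2)) powr 3"
    by (simp add: powr_powr)
  also have "\<dots> = arm R z ^ 3"
    unfolding 1 using nn by (simp add: arm_def powr_numeral)
  finally show "(R\<^sup>2 + 4 * z\<^sup>2) powr (3/2) = arm R z ^ 3" .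
qed

lemma DERIV_arm:
  assumes "0 < R"
  shows "((\<lambda>r. arm r z) has_real_derivative R / arm R z) (at R)"
    "((\<lambda>y. arm R y) has_real_derivative 4 * z / arm R z) (at z)"
proof -
  have "0 < R\<^sup>2 + 4 * z\<^sup>2" using assms by (simp add: add_pos_nonneg)
  then show "((\<lambda>r. arm r z) has_real_derivative R / arm R z) (at R)"
    "((\<lambda>y. arm R y) has_real_derivative 4 * z / arm R z) (at z)"
    unfolding arm_def by (auto intro!: derivative_eq_intros simp: field_simps)
qed

locale isosceles_schwarzschild =
  fixes M m A A1 B B1 C :: real
  assumes pos: "0 < M" "0 < m" "0 < A" "0 < A1" "0 < B" "0 < B1"
begin

definition H :: "real \<Rightarrow> real \<Rightarrow> real \<Rightarrow> real \<Rightarrow> real" where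
  "H = H_red M m A A1 B B1 C"

definition \<mu> :: real where "\<mu> = (2 * M + m) / m"

definition force_R :: "real \<Rightarrow> real \<Rightarrow> real" where
  "force_R R z = 2 * C\<^sup>2 / (M * R ^ 3) - A / R\<^sup>2 - 3 * B / R ^ 4
     - 4 * A1 * R / arm R z ^ 3 - 48 * B1 * R / arm R z ^ 5"

definition force_z :: "real \<Rightarrow> real \<Rightarrow> real" where
  "force_z R z = - 16 * A1 * z / arm R z ^ 3 - 192 * B1 * z / arm R z ^ 5"

lemma H_eq:
  "H R z p q = (p\<^sup>2 + C\<^sup>2 / R\<^sup>2) / M + \<mu> * q\<^sup>2 / (4 * M)
     - A / R - B / R ^ 3 - 4 * A1 / arm R z - 16 * B1 / arm R z ^ 3"
  using pos by (simp add: H_def H_red_def arm_powr \<mu>_def divide_simps)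

lemma hamiltonian_field_eq:
  assumes "0 < R"
  shows "hamiltonian_field H (R, z, p, q) = (2 * p / M, \<mu> * q / (2 * M), force_R R z, force_z R z)"
proof -
  note a = arm_pos[OF assms, of z]
  have "((\<lambda>p. H R z p q) has_real_derivative 2 * p / M) (at p)"
    unfolding H_eq using pos by (auto intro!: derivative_eq_intros)
  moreover have "((\<lambda>q. H R z p q) has_real_derivative \<mu> * q / (2 * M)) (at q)"
    unfolding H_eq using pos by (auto intro!: derivative_eq_intros)
  moreover have "((\<lambda>r. H r z p q) has_real_derivative - force_R R z) (at R)"
    unfolding H_eq force_R_def using pos assms a
    by (auto intro!: derivative_eq_intros DERIV_arm simp: field_simps eval_nat_numeral)
  moreover have "((\<lambda>y. H R y p q) has_real_derivative - force_z R z) (at z)"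
    unfolding H_eq force_z_def using pos assms a
    by (auto intro!: derivative_eq_intros DERIV_arm simp: field_simps eval_nat_numeral)
  ultimately show ?thesis
    by (simp add: hamiltonian_field_def DERIV_imp_deriv)
qed

lemma bounded_lipschitz_on_phase_box_coordinates:
  shows "bounded_lipschitz_on (phase_box n) fst"
    and "bounded_lipschitz_on (phase_box n) (\<lambda>x. fst (snd x))"
    and "bounded_lipschitz_on (phase_box n) (\<lambda>x. fst (snd (snd x)))"
    and "bounded_lipschitz_on (phase_box n) (\<lambda>x. snd (snd (snd x)))"
    and "bounded_lipschitz_on (phase_box n) (\<lambda>x. arm (fst x) (fst (snd x)))"
proof -
  have bounded: "\<exists>K. \<forall>x\<in>phase_box n. \<bar>f x\<bar> \<le> K" if "continuous_on UNIV f" for f :: "phase \<Rightarrow> real"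
  proof -
    have "bounded (f ` phase_box n)"
      using that compact_phase_box
      by (intro compact_imp_bounded compact_continuous_image) (auto intro: continuous_on_subset)
    then show ?thesis by (auto simp: bounded_iff)
  qed
  have d: "dist (fst x) (fst y) \<le> dist x y" "dist (snd x) (snd y) \<le> dist x y" for x y :: "'x::metric_space \<times> 'y::metric_space"
    by (rule dist_fst_le dist_snd_le)+
  have d': "dist (fst x) (fst y) \<le> dist x y" "dist (fst (snd x)) (fst (snd y)) \<le> dist x y"
    "dist (fst (snd (snd x))) (fst (snd (snd y))) \<le> dist x y"
    "dist (snd (snd (snd x))) (snd (snd (snd y))) \<le> dist x y" for x y :: phase
    by (rule d order_trans[OF d(1) d(2)] order_trans[OF d(1) order_trans[OF d(2) d(2)]]
        order_trans[OF d(2) order_trans[OF d(2) d(2)]])+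
  show "bounded_lipschitz_on (phase_box n) fst"
    unfolding bounded_lipschitz_on_def
    by (intro conjI bounded continuous_intros exI[of _ 1] lipschitz_onI) (simp_all add: d')
  show "bounded_lipschitz_on (phase_box n) (\<lambda>x. fst (snd x))"
    unfolding bounded_lipschitz_on_def
    by (intro conjI bounded continuous_intros exI[of _ 1] lipschitz_onI) (simp_all add: d')
  show "bounded_lipschitz_on (phase_box n) (\<lambda>x. fst (snd (snd x)))"
    unfolding bounded_lipschitz_on_def
    by (intro conjI bounded continuous_intros exI[of _ 1] lipschitz_onI) (simp_all add: d')
  show "bounded_lipschitz_on (phase_box n) (\<lambda>x. snd (snd (snd x)))"
    unfolding bounded_lipschitz_on_def
    by (intro conjI bounded continuous_intros exI[of _ 1] lipschitz_onI) (simp_all add: d')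
  have arm_norm: "arm R z = norm (R, 2 * z)" for R z
    by (simp add: arm_def norm_Pair power_mult_distrib)
  have "dist (arm (fst x) (fst (snd x))) (arm (fst y) (fst (snd y))) \<le> 3 * dist x y" for x y :: phase
  proof -
    have "dist (arm (fst x) (fst (snd x))) (arm (fst y) (fst (snd y)))
        \<le> norm ((fst x, 2 * fst (snd x)) - (fst y, 2 * fst (snd y)))"
      unfolding arm_norm dist_real_def by (rule norm_triangle_ineq3)
    also have "\<dots> \<le> \<bar>fst x - fst y\<bar> + \<bar>2 * fst (snd x) - 2 * fst (snd y)\<bar>"
      using norm_Pair_le[of "fst x - fst y" "2 * fst (snd x) - 2 * fst (snd y)"] by simp
    also have "\<dots> = dist (fst x) (fst y) + 2 * dist (fst (snd x)) (fst (snd y))"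
      by (simp add: dist_real_def abs_if)
    also have "\<dots> \<le> 3 * dist x y"
      using d(1)[of x y] order_trans[OF d(1) d(2), of x y] by linarith
    finally show ?thesis .
  qed
  then show "bounded_lipschitz_on (phase_box n) (\<lambda>x. arm (fst x) (fst (snd x)))"
    unfolding bounded_lipschitz_on_def
    by (intro conjI bounded exI[of _ 3] lipschitz_onI) (auto simp: arm_def intro!: continuous_intros)
qed

lemma hamiltonian_field_lipschitz: "\<exists>L. L-lipschitz_on (phase_box n) (hamiltonian_field H)"
proof -
  let ?K = "phase_box n"
  note coord = bounded_lipschitz_on_phase_box_coordinates[of n]
  have pos_R: "0 < 1 / (real n + 1)" and R_ge: "x \<in> ?K \<Longrightarrow> 1 / (real n + 1) \<le> fst x" for x
    by (auto simp: phase_box_def Let_def)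
  have arm_ge': "x \<in> ?K \<Longrightarrow> 1 / (real n + 1) \<le> arm (fst x) (fst (snd x))" for x
    using R_ge[of x] pos_R arm_ge[of "fst x" "fst (snd x)"] by linarith
  note inv = bounded_lipschitz_on_inverse[OF coord(1) pos_R R_ge]
    bounded_lipschitz_on_inverse[OF coord(5) pos_R arm_ge']
  let ?g = "\<lambda>x. (2 * inverse M * fst (snd (snd x)), \<mu> * inverse (2 * M) * snd (snd (snd x)),
     2 * C\<^sup>2 * inverse M * inverse (fst x) ^ 3 + (- A) * inverse (fst x) ^ 2
       + (- 3 * B) * inverse (fst x) ^ 4
       + (- 4 * A1) * fst x * inverse (arm (fst x) (fst (snd x))) ^ 3
       + (- 48 * B1) * fst x * inverse (arm (fst x) (fst (snd x))) ^ 5,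
     (- 16 * A1) * fst (snd x) * inverse (arm (fst x) (fst (snd x))) ^ 3
       + (- 192 * B1) * fst (snd x) * inverse (arm (fst x) (fst (snd x))) ^ 5)"
  have eq: "?g x = hamiltonian_field H x" if x: "x \<in> ?K" for x
  proof -
    obtain R z p q where x_def: "x = (R, z, p, q)" by (cases x)
    have "0 < R" using less_le_trans[OF pos_R R_ge[OF x]] by (simp add: x_def)
    then show ?thesis
      using arm_pos[of R z] pos
      unfolding x_def hamiltonian_field_eq[OF \<open>0 < R\<close>] force_R_def force_z_def fst_conv snd_conv prod.inject
      by (intro conjI) (simp_all add: field_simps)
  qed
  have "\<exists>L. L-lipschitz_on ?K ?g"
    by (intro bounded_lipschitz_on_Pair bounded_lipschitz_on_add bounded_lipschitz_on_mult
        bounded_lipschitz_on_power bounded_lipschitz_on_const coord inv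
        iffD1[OF bounded_lipschitz_on_def, THEN conjunct2])
  then obtain L where L: "L-lipschitz_on ?K ?g" by blast
  have "L-lipschitz_on ?K (hamiltonian_field H)"
    using L lipschitz_on_cong[OF refl refl, of ?K ?g "hamiltonian_field H" L] eq by blast
  then show ?thesis by blast
qed

sublocale locally_lipschitz_hamiltonian H
  by unfold_locales (rule hamiltonian_field_lipschitz)

end

section \<open>The trapping region\<close>

text \<open>
  Continuous induction: there is no first time at which \<open>f\<close> reaches \<open>c\<close>.
\<close>

lemma continuous_stays_below:
  fixes f :: "real \<Rightarrow> real"
  assumes "continuous_on {0..T} f" "f 0 < c"
    and step: "\<And>t. 0 < t \<Longrightarrow> t \<le> T \<Longrightarrow> (\<And>s. 0 \<le> s \<Longrightarrow> s < t \<Longrightarrow> f s < c) \<Longrightarrow> f t < c"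
    and t: "0 \<le> t" "t \<le> T"
  shows "f t < c"
proof (rule ccontr)
  assume "\<not> f t < c"
  define S where "S = {s \<in> {0..T}. c \<le> f s}"
  have S: "closed S" "bdd_below S" "S \<noteq> {}"
    using t \<open>\<not> f t < c\<close> continuous_closed_preimage[OF assms(1) closed_atLeastAtMost closed_atLeast[of c]]
    by (auto simp: S_def vimage_def Int_def intro!: bdd_belowI[of _ 0])
  have inS: "Inf S \<in> S" using closed_contains_Inf[OF S(3,2,1)] .
  have below: "f s < c" if "0 \<le> s" "s < Inf S" for s
  proof (rule ccontr)
    assume "\<not> f s < c"
    then have "s \<in> S" using that inS by (auto simp: S_def)
    then show False using cInf_lower[OF _ S(2)] that(2) by force
  qed
  have mem: "0 \<le> Inf S" "Inf S \<le> T" "c \<le> f (Inf S)" using inS unfolding S_def by auto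
  have "Inf S \<noteq> 0"
  proof
    assume "Inf S = 0"
    with mem(3) \<open>f 0 < c\<close> show False by simp
  qed
  with mem below have "f (Inf S) < c" by (intro step[of "Inf S"]) auto
  with mem(3) show False by simp
qed

context isosceles_schwarzschild
begin

text \<open>
  The potential of the leading terms in the rescaled equation of motion of the shape \<open>s = z / R\<close>.
  Its derivative, in \<open>DERIV_shape_well\<close>, compares the attraction of \<open>z\<close> towards \<open>0\<close> with the contraction
  of \<open>R\<close>.
\<close>

definition shape_well :: "real \<Rightarrow> real" where
  "shape_well s = 2 / M * (4 * (\<mu> - 1) * B1 * (1 - 1 / arm 1 s ^ 3) - 3 / 2 * B * s\<^sup>2)"

text \<open>
  This is \<open>R * z' - z * R' = R\<^sup>2 * (z / R)'\<close> along solutions.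
\<close>

definition shape_momentum :: "real \<Rightarrow> real \<Rightarrow> real \<Rightarrow> real \<Rightarrow> real" where
  "shape_momentum R z p q = \<mu> / (2 * M) * (R * q) - 2 / M * (z * p)"

definition shape_energy :: "real \<Rightarrow> real \<Rightarrow> real \<Rightarrow> real \<Rightarrow> real" where
  "shape_energy R z p q = R * (shape_momentum R z p q)\<^sup>2 / 2 + shape_well (z / R)"

lemma \<mu>_gt_1: "1 < \<mu>"
  using pos by (simp add: \<mu>_def)

lemma arm_scale: "0 < R \<Longrightarrow> arm R z = R * arm 1 (z / R)"
proof -
  assume R: "0 < R"
  have "R\<^sup>2 + 4 * z\<^sup>2 = R\<^sup>2 * (1 + 4 * (z / R)\<^sup>2)" using R by (simp add: field_simps)
  then show ?thesis using R by (simp add: arm_def real_sqrt_mult)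
qed

lemma DERIV_shape_well:
  "(shape_well has_real_derivative 2 / M * s * (48 * (\<mu> - 1) * B1 / arm 1 s ^ 5 - 3 * B)) (at s)"
proof -
  have a: "0 < arm 1 s" by (simp add: arm_pos)
  show ?thesis
    unfolding shape_well_def[abs_def]
    by (rule derivative_eq_intros DERIV_arm refl | use a pos in \<open>simp; fail\<close>)+
      (use a pos in \<open>simp add: field_simps eval_nat_numeral\<close>)
qed

lemma arm_1_ge_1: "1 \<le> arm 1 s"
  by (simp add: arm_def)

lemma shape_well_even: "shape_well \<bar>s\<bar> = shape_well s"
  by (simp add: shape_well_def arm_def)

text \<open>
  The derivative of \<open>shape_well\<close> at \<open>s\<close> is \<open>s\<close> times a continuous function whose value at \<open>0\<close> is a positive
  multiple of \<open>16 * B1 * (\<mu> - 1) - B\<close>.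
\<close>

lemma ex_shape_well_barrier:
  assumes "1 + B / (16 * B1) < \<mu>"
  shows "\<exists>s0>0. 0 < shape_well s0 \<and> (\<forall>s. \<bar>s\<bar> \<le> s0 \<longrightarrow> 0 \<le> shape_well s)"
proof -
  define k where "k s = 48 * (\<mu> - 1) * B1 / arm 1 s ^ 5 - 3 * B" for s
  have "isCont k 0"
    unfolding k_def arm_def by (intro continuous_intros) auto
  moreover have "0 < k 0"
    using assms pos by (simp add: k_def arm_def field_simps)
  ultimately have "eventually (\<lambda>s. 0 < k s) (at 0)"
    by (auto simp: isCont_def dest: order_tendstoD)
  then obtain d where d: "d > 0" "\<And>s. s \<noteq> 0 \<Longrightarrow> \<bar>s\<bar> < d \<Longrightarrow> 0 < k s"
    unfolding eventually_at by (auto simp: dist_real_def)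
  have well_pos: "0 < shape_well s" if "0 < s" "s \<le> d / 2" for s
  proof -
    have "shape_well 0 < shape_well s"
    proof (rule DERIV_pos_imp_increasing_open[OF that(1)])
      show "\<exists>y. (shape_well has_real_derivative y) (at r) \<and> 0 < y" if "0 < r" "r < s" for r
      proof (intro exI conjI)
        show "(shape_well has_real_derivative 2 / M * r * k r) (at r)"
          using DERIV_shape_well[of r] by (simp add: k_def)
        show "0 < 2 / M * r * k r" using d(2)[of r] that \<open>s \<le> d / 2\<close> d(1) pos by simp
      qed
      show "continuous_on {0..s} shape_well"
        using DERIV_shape_well by (meson DERIV_isCont continuous_at_imp_continuous_on)
    qed
    then show ?thesis by (simp add: shape_well_def arm_def)
  qed
  have "0 \<le> shape_well s" if "\<bar>s\<bar> \<le> d / 2" for s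
  proof (cases "s = 0")
    case True then show ?thesis by (simp add: shape_well_def arm_def)
  next
    case False
    then show ?thesis using well_pos[of "\<bar>s\<bar>"] that by (simp add: shape_well_even)
  qed
  with d(1) well_pos[of "d / 2"] show ?thesis by (intro exI[of _ "d / 2"]) auto
qed

text \<open>
  Bound for the terms of the potential other than those of order \<open>-3\<close>, as they occur in
  \<open>DERIV_shape_energy\<close>, for \<open>R < 1\<close>.
\<close>

definition lower_order_bound :: real where
  "lower_order_bound = 4 * (\<mu> - 1) * A1 + A + 2 * C\<^sup>2 / M"

text \<open>
  The multiple of \<open>R\<close> that absorbs the growth of the shape energy. While the solution is trapped, the
  growth rate is at most this number times \<open>- R'\<close>, because \<open>\<bar>s\<bar> \<le> s0\<close> and
  \<open>\<bar>L\<bar> / R \<le> 2 * sqrt (shape_well s0 / (M * B)) * (- P_R)\<close>, where \<open>L\<close> is the shape momentum.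
\<close>

definition drift :: "real \<Rightarrow> real" where
  "drift s0 = 2 * s0 * lower_order_bound * sqrt (shape_well s0 / (M * B))"

text \<open>
  The contributions of the terms of order \<open>-3\<close> cancel against the derivative of \<open>shape_well\<close>; this is
  how \<open>shape_well\<close> is found. What remains is the friction term, negative when \<open>R\<close> shrinks, and a
  product of \<open>s * l / R\<close> with terms of lower order.
\<close>

lemma DERIV_shape_energy:
  fixes R z p q :: "real \<Rightarrow> real"
  assumes R: "(R has_real_derivative 2 * p t / M) (at t)"
    and z: "(z has_real_derivative \<mu> * q t / (2 * M)) (at t)"
    and p: "(p has_real_derivative force_R (R t) (z t)) (at t)"
    and q: "(q has_real_derivative force_z (R t) (z t)) (at t)"
    and R0: "0 < R t"
  defines "l \<equiv> shape_momentum (R t) (z t) (p t) (q t)" and "s \<equiv> z t / R t"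
  shows "((\<lambda>t. shape_energy (R t) (z t) (p t) (q t)) has_real_derivative
    p t / M * l\<^sup>2 - 2 / M * (s * l / R t) *
      (R t * (4 * (\<mu> - 1) * A1 / arm 1 s ^ 3 - A) + 2 * C\<^sup>2 / M)) (at t)"
proof -
  define D where "D = arm 1 s"
  have D: "0 < D" by (simp add: D_def arm_pos)
  have z_eq: "z t = s * R t" and arm_eq: "arm (R t) (z t) = R t * D"
    using R0 arm_scale[OF R0, of "z t"] by (simp_all add: s_def D_def)
  have l': "((\<lambda>t. shape_momentum (R t) (z t) (p t) (q t)) has_real_derivative
      \<mu> * R t * force_z (R t) (z t) / (2 * M) - 2 * z t * force_R (R t) (z t) / M) (at t)"
    unfolding shape_momentum_def
    by (rule DERIV_cong[OF DERIV_diff[OF DERIV_cmult[OF DERIV_mult[OF R q]] DERIV_cmult[OF DERIV_mult[OF z p]]]])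
      (use pos in \<open>simp add: field_simps\<close>)
  have s': "((\<lambda>t. z t / R t) has_real_derivative l / (R t)\<^sup>2) (at t)"
    by (rule DERIV_cong[OF DERIV_divide[OF z R]])
      (use pos R0 in \<open>simp_all add: l_def shape_momentum_def field_simps power2_eq_square\<close>)
  have "((\<lambda>t. shape_energy (R t) (z t) (p t) (q t)) has_real_derivative
     (2 * p t / M) * l\<^sup>2 / 2
     + R t * l * (\<mu> * R t * force_z (R t) (z t) / (2 * M) - 2 * z t * force_R (R t) (z t) / M)
     + 2 / M * s * (48 * (\<mu> - 1) * B1 / D ^ 5 - 3 * B) * (l / (R t)\<^sup>2)) (at t)"
    unfolding shape_energy_def
    by (rule DERIV_cong[OF DERIV_add[OF DERIV_cdivide[OF DERIV_mult[OF R DERIV_power[OF l', of 2]]]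
            DERIV_chain2[OF DERIV_shape_well s']]])
      (simp add: l_def[symmetric] s_def[symmetric] D_def[symmetric] field_simps)
  moreover have "(2 * p t / M) * l\<^sup>2 / 2
     + R t * l * (\<mu> * R t * force_z (R t) (z t) / (2 * M) - 2 * z t * force_R (R t) (z t) / M)
     + 2 / M * s * (48 * (\<mu> - 1) * B1 / D ^ 5 - 3 * B) * (l / (R t)\<^sup>2)
    = p t / M * l\<^sup>2 - 2 / M * (s * l / R t) *
      (R t * (4 * (\<mu> - 1) * A1 / D ^ 3 - A) + 2 * C\<^sup>2 / M)"
    unfolding force_z_def force_R_def arm_eq unfolding z_eq
    using pos R0 D by (simp add: field_simps eval_nat_numeral)
  ultimately show ?thesis unfolding D_def[symmetric] by (rule DERIV_cong)
qed

text \<open>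
  The fourth condition is that the shape is inside the barrier of the well, the last one that its
  energy, with the reserve for later error terms, does not suffice to cross it. The third one makes
  the centrifugal term at most half as large as the attraction of the equal masses.
\<close>

definition trap :: "real \<Rightarrow> phase set" where
  "trap s0 = {(R, z, p, q). 0 < R \<and> R < 1 \<and> 4 * C\<^sup>2 * R < 3 * B * M \<and> \<bar>z\<bar> < s0 * R \<and> p < 0
     \<and> M * B / 2 < p\<^sup>2 * R ^ 3 \<and> shape_energy R z p q + drift s0 * R < shape_well s0}"

text \<open>
  The motion of \<open>R\<close> is controlled first, without regard to \<open>z\<close>: \<open>P_R\<close> stays negative, and
  \<open>P_R\<^sup>2 - M B / (2 R\<^sup>3)\<close> is nondecreasing. Then \<open>\<bar>z / R\<bar> < s0\<close> and \<open>F < shape_well s0\<close>, for the corrected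
  energy \<open>F\<close>, are propagated together, since each is needed to keep the other: the second one bounds the shape
  momentum, which makes \<open>F\<close> nonincreasing as long as the first one holds, and at \<open>\<bar>z / R\<bar> = s0\<close> the energy would
  have to be at least \<open>shape_well s0\<close>.
\<close>

lemma trapped:
  fixes R z p q :: "real \<Rightarrow> real"
  assumes s0: "0 < s0" "0 < shape_well s0" "\<And>s. \<bar>s\<bar> \<le> s0 \<Longrightarrow> 0 \<le> shape_well s"
    and init: "(R 0, z 0, p 0, q 0) \<in> trap s0"
    and R: "\<And>t. 0 \<le> t \<Longrightarrow> t \<le> T \<Longrightarrow> (R has_real_derivative 2 * p t / M) (at t)"
    and z: "\<And>t. 0 \<le> t \<Longrightarrow> t \<le> T \<Longrightarrow> (z has_real_derivative \<mu> * q t / (2 * M)) (at t)"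
    and p: "\<And>t. 0 \<le> t \<Longrightarrow> t \<le> T \<Longrightarrow> (p has_real_derivative force_R (R t) (z t)) (at t)"
    and q: "\<And>t. 0 \<le> t \<Longrightarrow> t \<le> T \<Longrightarrow> (q has_real_derivative force_z (R t) (z t)) (at t)"
    and R0: "\<And>t. 0 \<le> t \<Longrightarrow> t \<le> T \<Longrightarrow> 0 < R t"
    and T: "0 \<le> T"
  shows "p T < 0" "R T \<le> R 0" "M * B / 2 \<le> (p T)\<^sup>2 * R T ^ 3" "\<bar>z T\<bar> < s0 * R T"
proof -
  have init': "0 < R 0" "R 0 < 1" "4 * C\<^sup>2 * R 0 < 3 * B * M" "\<bar>z 0\<bar> < s0 * R 0" "p 0 < 0"
    "M * B / 2 < (p 0)\<^sup>2 * R 0 ^ 3"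
    "shape_energy (R 0) (z 0) (p 0) (q 0) + drift s0 * R 0 < shape_well s0"
    using init by (auto simp: trap_def)
  have cont: "continuous_on {0..T} R" "continuous_on {0..T} z" "continuous_on {0..T} p" "continuous_on {0..T} q"
    using R z p q by (auto intro!: continuous_at_imp_continuous_on DERIV_isCont)
  have sub: "continuous_on {0..t} f" if "continuous_on {0..T} f" "t \<le> T" for t and f :: "real \<Rightarrow> real"
    using that by (auto intro: continuous_on_subset)
  \<comment> \<open>half of the attraction between the equal masses outweighs the centrifugal term\<close>
  have force: "force_R r y \<le> - 3 * B / (2 * r ^ 4)" if "0 < r" "r \<le> R 0" for r y
  proof -
    have "4 * C\<^sup>2 * r \<le> 4 * C\<^sup>2 * R 0" using that by (intro mult_left_mono) auto
    then have "4 * C\<^sup>2 * r \<le> 3 * B * M" using init'(3) by linarith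
    then have "2 * C\<^sup>2 / (M * r ^ 3) \<le> 3 * B / (2 * r ^ 4)"
      using that pos by (simp add: field_simps eval_nat_numeral)
    moreover have "0 \<le> A / r\<^sup>2" "0 \<le> 4 * A1 * r / arm r y ^ 3" "0 \<le> 48 * B1 * r / arm r y ^ 5"
      using that pos arm_pos[of r y] by auto
    moreover have "3 * B / (2 * r ^ 4) = 3 * B / r ^ 4 / 2" "- 3 * B / (2 * r ^ 4) = - (3 * B / r ^ 4 / 2)"
      by simp_all
    ultimately show ?thesis unfolding force_R_def by linarith
  qed
  have R_le: "R t \<le> R 0" if "0 \<le> t" "t \<le> T" "\<And>s. 0 \<le> s \<Longrightarrow> s < t \<Longrightarrow> p s < 0" for t
  proof (rule DERIV_nonpos_imp_decreasing_open[OF that(1)])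
    show "\<exists>y. (R has_real_derivative y) (at s) \<and> y \<le> 0" if "0 < s" "s < t" for s
      using R[of s] that \<open>t \<le> T\<close> \<open>\<And>s. 0 \<le> s \<Longrightarrow> s < t \<Longrightarrow> p s < 0\<close>[of s] pos
      by (intro exI[of _ "2 * p s / M"]) (auto simp: divide_le_0_iff)
  qed (use sub cont that in blast)
  have p_neg: "p t < 0" if "0 \<le> t" "t \<le> T" for t
  proof (rule continuous_stays_below[OF cont(3) init'(5) _ that])
    fix t assume t: "0 < t" "t \<le> T" and neg: "\<And>s. 0 \<le> s \<Longrightarrow> s < t \<Longrightarrow> p s < 0"
    have "p t \<le> p 0"
    proof (rule DERIV_nonpos_imp_decreasing_open[of 0 t p])
      fix s assume s: "0 < s" "s < t"
      have "force_R (R s) (z s) \<le> - 3 * B / (2 * R s ^ 4)"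
        using s t neg by (intro force R_le R0) auto
      also have "\<dots> \<le> 0" using pos R0[of s] s t by (simp add: divide_le_0_iff)
      finally show "\<exists>y. (p has_real_derivative y) (at s) \<and> y \<le> 0"
        using p[of s] s t by (intro exI[of _ "force_R (R s) (z s)"]) auto
    qed (use sub cont t in auto)
    then show "p t < 0" using init'(5) by linarith
  qed
  have R_dec: "R t \<le> R 0" if "0 \<le> t" "t \<le> T" for t
    using that by (intro R_le p_neg) auto
  have p_big: "M * B / 2 \<le> (p t)\<^sup>2 * R t ^ 3" if t: "0 \<le> t" "t \<le> T" for t
  proof -
    \<comment> \<open>its derivative is \<open>2 * p\<close> times the excess in \<open>force\<close>, a product of two nonpositive numbers\<close>
    define N where "N t = (p t)\<^sup>2 - M * B / 2 * inverse (R t ^ 3)" for t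
    have "N 0 \<le> N t"
    proof (rule DERIV_nonneg_imp_nondecreasing[OF t(1)])
      fix s assume "0 \<le> s" "s \<le> t"
      then have s: "0 \<le> s" "s \<le> T" using t by auto
      have "(N has_real_derivative 2 * p s * (force_R (R s) (z s) + 3 * B / (2 * R s ^ 4))) (at s)"
        unfolding N_def
        by (rule derivative_eq_intros R[OF s] p[OF s] refl | use R0[OF s] in \<open>simp; fail\<close>)+
          (use R0[OF s] pos in \<open>simp add: field_simps eval_nat_numeral\<close>)
      moreover have "0 \<le> 2 * p s * (force_R (R s) (z s) + 3 * B / (2 * R s ^ 4))"
        using p_neg[OF s] force[OF R0[OF s] R_dec[OF s], of "z s"]
        by (intro mult_nonpos_nonpos) auto
      ultimately show "\<exists>y. (N has_real_derivative y) (at s) \<and> 0 \<le> y" by blast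
    qed
    moreover have "0 \<le> N 0" using init'(1,6) by (simp add: N_def field_simps)
    ultimately have "0 \<le> N t" by simp
    then show ?thesis using R0[OF t] by (simp add: N_def field_simps)
  qed
  define F where "F t = shape_energy (R t) (z t) (p t) (q t) + drift s0 * R t" for t
  define s where "s t = z t / R t" for t
  have s_cont: "continuous_on {0..T} s"
    unfolding s_def using R0 by (intro continuous_intros cont) (auto simp: less_imp_neq[symmetric])
  have lower_order_bound_pos: "0 < lower_order_bound"
    using pos \<mu>_gt_1 by (auto simp: lower_order_bound_def intro!: add_pos_nonneg)
  have lower_order_bound: "\<bar>r * (4 * (\<mu> - 1) * A1 / arm 1 y ^ 3 - A) + 2 * C\<^sup>2 / M\<bar> \<le> lower_order_bound" if "0 < r" "r < 1" for r y
  proof -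
    define a where "a = 4 * (\<mu> - 1) * A1 / arm 1 y ^ 3"
    have a: "0 \<le> a" "a \<le> 4 * (\<mu> - 1) * A1"
      unfolding a_def using pos \<mu>_gt_1 arm_1_ge_1[of y] by (auto simp: divide_le_eq intro!: mult_right_le_one_le mult_le_cancel_left1[THEN iffD2])
    have "\<bar>r * (a - A) + 2 * C\<^sup>2 / M\<bar> \<le> \<bar>r * (a - A)\<bar> + \<bar>2 * C\<^sup>2 / M\<bar>" by (rule abs_triangle_ineq)
    also have "\<dots> \<le> 1 * (a + A) + 2 * C\<^sup>2 / M"
    proof (rule add_mono)
      have "\<bar>a - A\<bar> \<le> a + A" using a(1) pos(3) by linarith
      then show "\<bar>r * (a - A)\<bar> \<le> 1 * (a + A)"
        unfolding abs_mult using that by (intro mult_mono) auto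
    qed (use pos in simp)
    also have "\<dots> \<le> lower_order_bound" using a(2) by (simp add: lower_order_bound_def)
    finally show ?thesis unfolding a_def .
  qed
  have F_deriv: "\<exists>y. (F has_real_derivative y) (at t) \<and> y \<le> 0"
    if t: "0 \<le> t" "t \<le> T" and st: "\<bar>s t\<bar> \<le> s0" and Ft: "F t \<le> shape_well s0" for t
  proof -
    let ?l = "shape_momentum (R t) (z t) (p t) (q t)"
    let ?n = "R t * (4 * (\<mu> - 1) * A1 / arm 1 (s t) ^ 3 - A) + 2 * C\<^sup>2 / M"
    note Rt = R0[OF t] and pt = p_neg[OF t]
    have "0 \<le> drift s0 * R t"
      using s0 lower_order_bound_pos Rt pos by (auto simp: drift_def intro!: mult_nonneg_nonneg)
    then have "R t * ?l\<^sup>2 / 2 \<le> shape_well s0"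
      using Ft s0(3)[OF st] by (simp add: F_def shape_energy_def s_def)
    then have "?l\<^sup>2 \<le> 2 * shape_well s0 / R t" using Rt by (simp add: field_simps)
    then have "(?l / R t)\<^sup>2 \<le> 2 * shape_well s0 / R t ^ 3"
      using Rt by (simp add: field_simps eval_nat_numeral)
    also have "\<dots> \<le> 4 * shape_well s0 / (M * B) * (p t)\<^sup>2"
      using mult_left_mono[OF p_big[OF t], of "4 * shape_well s0"] Rt s0(2) pos by (simp add: field_simps)
    also have "\<dots> = (2 * sqrt (shape_well s0 / (M * B)) * p t)\<^sup>2"
      using s0(2) pos by (simp add: power_mult_distrib)
    finally have "\<bar>?l / R t\<bar> \<le> \<bar>2 * sqrt (shape_well s0 / (M * B)) * p t\<bar>"
      unfolding abs_le_square_iff .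
    also have "\<dots> = 2 * sqrt (shape_well s0 / (M * B)) * (- p t)"
      using pt s0(2) pos by (simp add: abs_mult)
    finally have l: "\<bar>?l / R t\<bar> \<le> 2 * sqrt (shape_well s0 / (M * B)) * (- p t)" .
    have "- (a * b * c) \<le> \<bar>a\<bar> * \<bar>b\<bar> * \<bar>c\<bar>" for a b c :: real
      unfolding abs_mult[symmetric] by (rule abs_ge_minus_self)
    from this[of "s t" "?l / R t" ?n]
    have "- (s t * ?l / R t * ?n) \<le> \<bar>s t\<bar> * \<bar>?l / R t\<bar> * \<bar>?n\<bar>"
      unfolding times_divide_eq_right .
    also have "\<dots> \<le> s0 * (2 * sqrt (shape_well s0 / (M * B)) * (- p t)) * lower_order_bound"
    proof (intro mult_mono st l)
      show "\<bar>?n\<bar> \<le> lower_order_bound" using Rt R_dec[OF t] init'(2) by (intro lower_order_bound) auto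
      show "0 \<le> s0 * (2 * sqrt (shape_well s0 / (M * B)) * (- p t))"
        by (rule mult_nonneg_nonneg[OF less_imp_le[OF s0(1)] order_trans[OF abs_ge_zero l]])
    qed (use s0(1) in auto)
    also have "\<dots> = drift s0 * (- p t)" by (simp add: drift_def)
    finally have main: "- (s t * ?l / R t * ?n) \<le> drift s0 * (- p t)" .
    have "(F has_real_derivative
        (p t / M * ?l\<^sup>2 - 2 / M * (s t * ?l / R t) * ?n) + drift s0 * (2 * p t / M)) (at t)"
      unfolding F_def s_def using DERIV_shape_energy[OF R[OF t] z[OF t] p[OF t] q[OF t] Rt]
      by (intro DERIV_add DERIV_cmult R t)
    moreover have "(p t / M * ?l\<^sup>2 - 2 / M * (s t * ?l / R t) * ?n) + drift s0 * (2 * p t / M) \<le> 0"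
    proof -
      have "p t / M * ?l\<^sup>2 \<le> 0" using pt pos by (auto simp: mult_le_0_iff divide_le_0_iff)
      moreover have "2 / M * (- (s t * ?l / R t * ?n)) \<le> 2 / M * (drift s0 * (- p t))"
        using main pos by (intro mult_left_mono) auto
      moreover have "a - 2 / M * y * n + d * (2 * P / M) = a + (2 / M * (- (y * n)) - 2 / M * (d * (- P)))"
        for a y n d P :: real by (simp add: algebra_simps)
      ultimately show ?thesis by (metis add_nonpos_nonpos diff_le_0_iff_le)
    qed
    ultimately show ?thesis by blast
  qed
  have F_cont: "continuous_on {0..T} F"
  proof -
    have "isCont F t" if t: "t \<in> {0..T}" for t
    proof -
      have t': "0 \<le> t" "t \<le> T" using t by auto
      show ?thesis
        unfolding F_def
        by (intro continuous_intros DERIV_isCont[OF DERIV_shape_energy[OF R[OF t'] z[OF t'] p[OF t'] q[OF t'] R0[OF t']]]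
          DERIV_isCont[OF R[OF t']])
    qed
    then show ?thesis by (auto intro: continuous_at_imp_continuous_on)
  qed
  have F0: "F 0 < shape_well s0" using init'(7) by (simp add: F_def)
  have well_le: "shape_well (s t) \<le> F t" if "0 \<le> t" "t \<le> T" for t
    using R0[OF that] s0 lower_order_bound_pos pos
    by (auto simp: F_def shape_energy_def s_def drift_def intro!: add_nonneg_nonneg mult_nonneg_nonneg)
  \<comment> \<open>one function that is negative exactly if both bounds hold\<close>
  define f where "f t = max (\<bar>s t\<bar> - s0) (F t - shape_well s0)" for t
  have "f T < 0"
  proof (rule continuous_stays_below[of T f 0 T])
    show "continuous_on {0..T} f" unfolding f_def by (intro continuous_intros s_cont F_cont)
    show "f 0 < 0" using F0 init'(1,4) by (simp add: f_def s_def field_simps)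
    fix t assume t: "0 < t" "t \<le> T" and *: "\<And>r. 0 \<le> r \<Longrightarrow> r < t \<Longrightarrow> f r < 0"
    have less: "\<bar>s r\<bar> < s0" "F r < shape_well s0" if "0 \<le> r" "r < t" for r
      using *[OF that] by (auto simp: f_def)
    have "F t \<le> F 0"
    proof (rule DERIV_nonpos_imp_decreasing_open[of 0 t F])
      show "\<exists>y. (F has_real_derivative y) (at r) \<and> y \<le> 0" if "0 < r" "r < t" for r
        using less[of r] that t by (intro F_deriv) auto
    qed (use t sub[OF F_cont] in auto)
    with F0 have Ft: "F t < shape_well s0" by simp
    have "\<bar>s t\<bar> < s0"
    proof (rule ccontr)
      assume "\<not> \<bar>s t\<bar> < s0"
      then have "\<exists>r\<ge>0. r \<le> t \<and> \<bar>s r\<bar> = s0"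
        using less(1)[of 0] t sub[OF s_cont] by (intro IVT') (auto intro!: continuous_intros)
      then obtain r where r: "0 \<le> r" "r \<le> t" "\<bar>s r\<bar> = s0" by blast
      with less(1)[of r] have "r = t" by force
      with r(3) have "shape_well (s t) = shape_well s0" using shape_well_even[of "s t"] by simp
      with well_le[of t] Ft t show False by simp
    qed
    with Ft show "f t < 0" by (simp add: f_def)
  qed (use T in auto)
  then have "\<bar>s T\<bar> < s0" by (simp add: f_def)
  then show "\<bar>z T\<bar> < s0 * R T" using R0[of T] T by (simp add: s_def field_simps)
  show "p T < 0" "R T \<le> R 0" "M * B / 2 \<le> (p T)\<^sup>2 * R T ^ 3"
    using T p_neg R_dec p_big by auto
qed

end

section \<open>Collapse of trapped solutions\<close>

context isosceles_schwarzschild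
begin

text \<open>
  The end time is finite because \<open>R\<close> decreases at a rate bounded away from zero. If \<open>R\<close> did not tend to
  \<open>0\<close>, positions and hence forces and momenta would stay bounded up to that time, and the solution
  would remain in a compact set. So \<open>R\<close> tends to \<open>0\<close>, and \<open>z\<close> follows by \<open>\<bar>z\<bar> < s0 R\<close>.
\<close>

theorem trap_leads_to_triple_collision:
  assumes s0: "0 < s0" "0 < shape_well s0" "\<And>s. \<bar>s\<bar> \<le> s0 \<Longrightarrow> 0 \<le> shape_well s"
    and init: "x0 \<in> trap s0"
  shows "leads_to_triple_collision H x0"
proof -
  have x0: "x0 \<in> phase_space" using init by (auto simp: trap_def phase_space_def)
  define R where "R t = fst (trajectory x0 t)" for t
  define z where "z t = fst (snd (trajectory x0 t))" for t
  define p where "p t = fst (snd (snd (trajectory x0 t)))" for t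
  define q where "q t = snd (snd (snd (trajectory x0 t)))" for t
  have traj: "trajectory x0 t = (R t, z t, p t, q t)" for t
    by (simp add: R_def z_def p_def q_def)
  have R_pos: "0 < R t"
    and deriv: "(trajectory x0 has_vector_derivative
        (2 * p t / M, \<mu> * q t / (2 * M), force_R (R t) (z t), force_z (R t) (z t))) (at t)"
    if t: "0 \<le> t" "ereal t < end_time x0" for t
  proof -
    have "t \<in> einterval (start_time x0) (end_time x0)"
      by (rule mem_einterval_nonneg[OF start_end_time(1)[OF x0] t])
    with trajectory_solution[OF x0]
    have sol: "trajectory x0 t \<in> phase_space"
      "(trajectory x0 has_vector_derivative hamiltonian_field H (trajectory x0 t)) (at t)"
      by (auto simp: solution_on_def)
    from sol(1) show "0 < R t" by (simp add: traj phase_space_def)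
    with sol(2) show "(trajectory x0 has_vector_derivative
        (2 * p t / M, \<mu> * q t / (2 * M), force_R (R t) (z t), force_z (R t) (z t))) (at t)"
      by (simp add: traj[of t] hamiltonian_field_eq)
  qed
  note lin = bounded_linear_fst bounded_linear_snd
  have R': "(R has_real_derivative 2 * p t / M) (at t)"
    and z': "(z has_real_derivative \<mu> * q t / (2 * M)) (at t)"
    and p': "(p has_real_derivative force_R (R t) (z t)) (at t)"
    and q': "(q has_real_derivative force_z (R t) (z t)) (at t)"
    if t: "0 \<le> t" "ereal t < end_time x0" for t
  proof -
    note 1 = bounded_linear.has_vector_derivative[OF lin(1) deriv[OF t]]
    note s1 = bounded_linear.has_vector_derivative[OF lin(2) deriv[OF t]]
    note 2 = bounded_linear.has_vector_derivative[OF lin(1) s1]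
    note s2 = bounded_linear.has_vector_derivative[OF lin(2) s1]
    note 3 = bounded_linear.has_vector_derivative[OF lin(1) s2]
    note 4 = bounded_linear.has_vector_derivative[OF lin(2) s2]
    show "(R has_real_derivative 2 * p t / M) (at t)"
      using 1 unfolding has_real_derivative_iff_has_vector_derivative R_def by simp
    show "(z has_real_derivative \<mu> * q t / (2 * M)) (at t)"
      using 2 unfolding has_real_derivative_iff_has_vector_derivative z_def by simp
    show "(p has_real_derivative force_R (R t) (z t)) (at t)"
      using 3 unfolding has_real_derivative_iff_has_vector_derivative p_def by simp
    show "(q has_real_derivative force_z (R t) (z t)) (at t)"
      using 4 unfolding has_real_derivative_iff_has_vector_derivative q_def by simp
  qed
  have before: "ereal s < end_time x0" if "s \<le> t" "ereal t < end_time x0" for s t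
    using that by (auto intro: le_less_trans[of _ "ereal t"])
  have init': "(R 0, z 0, p 0, q 0) \<in> trap s0"
    using init trajectory_0[OF x0] traj[of 0] by simp
  have R0: "0 < R 0" "R 0 < 1" using init' by (auto simp: trap_def)
  have stay: "p t < 0" "R t \<le> R 0" "M * B / 2 \<le> (p t)\<^sup>2 * R t ^ 3" "\<bar>z t\<bar> < s0 * R t"
    if t: "0 \<le> t" "ereal t < end_time x0" for t
    using trapped[OF s0 init' R' z' p' q' R_pos t(1)] before t(2) by blast+
  have R_antimono: "R t \<le> R s" if "0 \<le> s" "s \<le> t" "ereal t < end_time x0" for s t
  proof (rule DERIV_nonpos_imp_nonincreasing[OF that(2)])
    fix r assume r: "s \<le> r" "r \<le> t"
    then have r': "0 \<le> r" "ereal r < end_time x0" using that before by auto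
    show "\<exists>y. (R has_real_derivative y) (at r) \<and> y \<le> 0"
      using R'[OF r'] stay(1)[OF r'] pos by (intro exI[of _ "2 * p r / M"]) (auto simp: divide_le_0_iff)
  qed
  have "\<exists>b. end_time x0 = ereal b"
  proof -
    define c where "c = sqrt (M * B / 2)"
    have c: "0 < c" using pos by (simp add: c_def)
    have fast: "p t \<le> - c" if t: "0 \<le> t" "ereal t < end_time x0" for t
    proof -
      have "R t ^ 3 \<le> 1" using stay(2)[OF t] R0 R_pos[OF t] by (intro power_le_one) auto
      then have "(p t)\<^sup>2 * R t ^ 3 \<le> (p t)\<^sup>2 * 1" by (intro mult_left_mono) auto
      then have "M * B / 2 \<le> (p t)\<^sup>2" using stay(3)[OF t] by simp
      then have "c \<le> \<bar>p t\<bar>" unfolding c_def by (metis real_sqrt_abs real_sqrt_le_mono)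
      then show ?thesis using stay(1)[OF t] by simp
    qed
    have bound: "2 * c / M * t \<le> 1" if t: "0 \<le> t" "ereal t < end_time x0" for t
    proof -
      have "R t + 2 * c / M * t \<le> R 0 + 2 * c / M * 0"
      proof (rule DERIV_nonpos_imp_nonincreasing[OF t(1)])
        fix r assume r: "0 \<le> r" "r \<le> t"
        then have r': "0 \<le> r" "ereal r < end_time x0" using t before by auto
        have "((\<lambda>t. R t + 2 * c / M * t) has_real_derivative 2 * p r / M + 2 * c / M * 1) (at r)"
          by (intro DERIV_add R' r' DERIV_cmult DERIV_ident)
        moreover have "2 * p r / M + 2 * c / M * 1 \<le> 0"
          using fast[OF r'] pos by (simp add: field_simps)
        ultimately show "\<exists>y. ((\<lambda>t. R t + 2 * c / M * t) has_real_derivative y) (at r) \<and> y \<le> 0" by blast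
      qed
      with R0 R_pos[OF t] show ?thesis by simp
    qed
    have "end_time x0 \<noteq> \<infinity>"
    proof
      assume "end_time x0 = \<infinity>"
      then have "2 * c / M * (M / c) \<le> 1" using c pos by (intro bound) auto
      then show False using c pos by simp
    qed
    with start_end_time(2)[OF x0] show ?thesis by (cases "end_time x0") auto
  qed
  then obtain b where b: "end_time x0 = ereal b" by blast
  have b_pos: "0 < b" using start_end_time(2)[OF x0] b by simp
  have collapse: "\<exists>t. 0 \<le> t \<and> t < b \<and> R t < e" if "0 < e" for e
  proof (rule ccontr)
    assume "\<not> ?thesis"
    then have R_ge: "e \<le> R t" if "0 \<le> t" "t < b" for t using that by force
    let ?S = "{e..1} \<times> {- s0..s0}"
    have in_S: "(R t, z t) \<in> ?S" if t: "0 \<le> t" "t < b" for t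
    proof -
      have t': "ereal t < end_time x0" using t b by simp
      have "s0 * R t \<le> s0 * 1" using stay(2)[OF t(1) t'] R0 s0 by (intro mult_left_mono) auto
      with stay(2,4)[OF t(1) t'] R0 R_ge[OF t] show ?thesis by auto
    qed
    have nz: "u \<in> ?S \<Longrightarrow> fst u \<noteq> 0 \<and> arm (fst u) (snd u) \<noteq> 0" for u
      using \<open>0 < e\<close> arm_pos[of "fst u" "snd u"] by auto
    have arm_cont: "continuous_on ?S (\<lambda>u. arm (fst u) (snd u))"
      unfolding arm_def by (intro continuous_intros)
    have cont: "continuous_on ?S (\<lambda>u. force_R (fst u) (snd u))" "continuous_on ?S (\<lambda>u. force_z (fst u) (snd u))"
      unfolding force_R_def force_z_def using nz pos by (auto intro!: continuous_intros arm_cont)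
    have "bounded ((\<lambda>u. force_R (fst u) (snd u)) ` ?S)" "bounded ((\<lambda>u. force_z (fst u) (snd u)) ` ?S)"
      by (intro compact_imp_bounded compact_continuous_image cont compact_Times compact_Icc)+
    then obtain K1 K2 where "\<forall>y\<in>(\<lambda>u. force_R (fst u) (snd u)) ` ?S. norm y \<le> K1"
      and "\<forall>y\<in>(\<lambda>u. force_z (fst u) (snd u)) ` ?S. norm y \<le> K2"
      unfolding bounded_iff by blast
    then have K1: "\<bar>force_R (R t) (z t)\<bar> \<le> K1" and K2: "\<bar>force_z (R t) (z t)\<bar> \<le> K2"
      if "0 \<le> t" "t < b" for t
      using in_S[OF that] by force+
    have bound: "\<bar>f t\<bar> \<le> \<bar>f 0\<bar> + \<bar>K\<bar> * b"
      if f: "\<And>t. 0 \<le> t \<Longrightarrow> ereal t < end_time x0 \<Longrightarrow> (f has_real_derivative f' t) (at t)"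
      and K: "\<And>t. 0 \<le> t \<Longrightarrow> t < b \<Longrightarrow> \<bar>f' t\<bar> \<le> K" and t: "0 \<le> t" "t < b" for f f' :: "real \<Rightarrow> real" and K t
    proof -
      have "norm (f t - f 0) \<le> K * norm (t - 0)"
      proof (rule field_differentiable_bound[of "{0..t}" f f'])
        show "(f has_real_derivative f' s) (at s within {0..t})" if "s \<in> {0..t}" for s
          using f[of s] that t b by (auto intro: has_field_derivative_at_within)
      qed (use K t in auto)
      also have "\<dots> \<le> \<bar>K\<bar> * b" unfolding real_norm_def using t by (intro mult_mono) auto
      finally show ?thesis unfolding real_norm_def by linarith
    qed
    let ?P = "\<bar>p 0\<bar> + \<bar>K1\<bar> * b" and ?Q = "\<bar>q 0\<bar> + \<bar>K2\<bar> * b"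
    let ?T = "{e..1} \<times> {- s0..s0} \<times> {- ?P..?P} \<times> {- ?Q..?Q}"
    have "compact ?T" by (intro compact_Times compact_Icc)
    moreover have "?T \<subseteq> phase_space" using \<open>0 < e\<close> by (auto simp: phase_space_def)
    ultimately obtain n where n: "?T \<subseteq> phase_box n"
      using compact_subset_phase_box by blast
    have "trajectory x0 t \<in> ?T" if t: "0 \<le> t" "t < b" for t
    proof -
      have "\<bar>p t\<bar> \<le> ?P" "\<bar>q t\<bar> \<le> ?Q"
        using bound[OF p' K1 t] bound[OF q' K2 t] by auto
      then have "- ?P \<le> p t" "p t \<le> ?P" "- ?Q \<le> q t" "q t \<le> ?Q" by linarith+
      with in_S[OF t] show ?thesis unfolding traj by simp
    qed
    with not_confined_to_phase_box[OF x0 b, of n] n show False by blast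
  qed
  show ?thesis
    unfolding leads_to_triple_collision_iff_trajectory[OF x0]
  proof (intro allI impI)
    fix e :: real assume "0 < e"
    then have "0 < e / (1 + s0)" using s0 by simp
    from collapse[OF this] obtain t0 where t0: "0 \<le> t0" "t0 < b" "R t0 < e / (1 + s0)" by blast
    have "norm (fst (trajectory x0 t), fst (snd (trajectory x0 t))) \<le> e"
      if t: "t0 \<le> t" "ereal t < end_time x0" for t
    proof -
      have t': "0 \<le> t" using t t0 by simp
      have "norm (R t, z t) \<le> \<bar>R t\<bar> + \<bar>z t\<bar>" using norm_Pair_le[of "R t" "z t"] by simp
      also have "\<dots> \<le> R t * (1 + s0)"
        using stay(4)[OF t' t(2)] R_pos[OF t' t(2)] by (simp add: algebra_simps)
      also have "\<dots> \<le> R t0 * (1 + s0)"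
        using R_antimono[OF t0(1) t] s0 by (intro mult_right_mono) auto
      also have "\<dots> \<le> e" using t0(3) s0 by (simp add: field_simps)
      finally show ?thesis by (simp add: traj)
    qed
    then show "\<exists>q\<ge>0. ereal q < end_time x0 \<and>
        (\<forall>t\<ge>q. ereal t < end_time x0 \<longrightarrow> norm (fst (trajectory x0 t), fst (snd (trajectory x0 t))) \<le> e)"
      using t0 b by (intro exI[of _ t0]) auto
  qed
qed

end

section \<open>Positive measure on every energy level\<close>

lemma eventually_nhds_less:
  fixes f :: "'a::t2_space \<Rightarrow> real"
  shows "isCont f a \<Longrightarrow> f a < c \<Longrightarrow> eventually (\<lambda>x. f x < c) (nhds a)"
  unfolding isCont_def tendsto_at_iff_tendsto_nhds by (rule order_tendstoD(2))

lemma eventually_nhds_greater: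
  fixes f :: "'a::t2_space \<Rightarrow> real"
  shows "isCont f a \<Longrightarrow> c < f a \<Longrightarrow> eventually (\<lambda>x. c < f x) (nhds a)"
  unfolding isCont_def tendsto_at_iff_tendsto_nhds by (rule order_tendstoD(1))

context isosceles_schwarzschild
begin

definition momentum_sq :: "real \<Rightarrow> real \<Rightarrow> real \<Rightarrow> real \<Rightarrow> real" where
  "momentum_sq h R z q = M * (h - H R z 0 q)"

text \<open>
  The energy level as a graph over \<open>(R, z, P_z)\<close>-space; the negative root is the branch on which \<open>R\<close>
  shrinks.
\<close>

definition lift :: "real \<Rightarrow> real \<times> real \<times> real \<Rightarrow> phase" where
  "lift h = (\<lambda>(R, z, q). (R, z, - sqrt (momentum_sq h R z q), q))"

lemma lift_in_energy_level:
  assumes "0 < R" "0 \<le> momentum_sq h R z q"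
  shows "lift h (R, z, q) \<in> energy_level H h"
proof -
  let ?p = "- sqrt (momentum_sq h R z q)"
  have "H R z ?p q = ?p\<^sup>2 / M + H R z 0 q"
    unfolding H_eq by (simp add: add_divide_distrib)
  also have "?p\<^sup>2 = M * (h - H R z 0 q)" using assms(2) by (simp add: momentum_sq_def)
  finally have "H R z ?p q = h" using pos by simp
  then show ?thesis using assms(1) by (simp add: lift_def energy_level_def phase_space_def)
qed

text \<open>
  At \<open>z = P_z = 0\<close> the energy equation reads \<open>P_R\<^sup>2 R\<^sup>3 = P R\<close> for a polynomial \<open>P\<close> with
  \<open>P 0 = M (B + 16 B1) > M B / 2\<close>, and the corrected shape energy is \<open>drift s0 * R\<close>. So all conditions of
  the trap hold there for small \<open>R\<close>, whatever \<open>h\<close> and \<open>C\<close> are, and they are open.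
\<close>

lemma ex_ball_in_trap:
  assumes "0 < shape_well s0" "0 < s0"
  shows "\<exists>c r. 0 < r \<and> (\<forall>u\<in>ball c r. lift h u \<in> trap s0 \<and> lift h u \<in> energy_level H h)"
proof -
  define P where "P r = M * (h * r ^ 3 + (A + 4 * A1) * r\<^sup>2 + B + 16 * B1 - C\<^sup>2 * r / M)" for r
  have "eventually (\<lambda>r. M * B / 2 < P r) (nhds 0)"
  proof (rule eventually_nhds_greater)
    have "B / 2 < B + 16 * B1" using pos by simp
    then have "M * (B / 2) < M * (B + 16 * B1)" using pos by (intro mult_strict_left_mono) auto
    then show "M * B / 2 < P 0" by (simp add: P_def)
  qed (use pos in \<open>auto simp: P_def intro!: continuous_intros\<close>)
  moreover have "eventually (\<lambda>r. r < 1) (nhds (0::real))"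
    "eventually (\<lambda>r. 4 * C\<^sup>2 * r < 3 * B * M) (nhds 0)"
    "eventually (\<lambda>r. drift s0 * r < shape_well s0) (nhds 0)"
    using pos assms by (auto intro!: eventually_nhds_less continuous_intros)
  ultimately have "eventually (\<lambda>r. M * B / 2 < P r \<and> r < 1 \<and> 4 * C\<^sup>2 * r < 3 * B * M \<and> drift s0 * r < shape_well s0) (nhds 0)"
    by (intro eventually_conj)
  then obtain d where d: "d > 0" "\<And>r. \<bar>r\<bar> < d \<Longrightarrow>
      M * B / 2 < P r \<and> r < 1 \<and> 4 * C\<^sup>2 * r < 3 * B * M \<and> drift s0 * r < shape_well s0"
    unfolding eventually_nhds_metric by (auto simp: dist_real_def)
  define R0 where "R0 = d / 2"
  have R0: "0 < R0" "M * B / 2 < P R0" "R0 < 1" "4 * C\<^sup>2 * R0 < 3 * B * M" "drift s0 * R0 < shape_well s0"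
    using d(1) d(2)[of R0] by (auto simp: R0_def)
  define c :: "real \<times> real \<times> real" where "c = (R0, 0, 0)"
  define g where "g u = momentum_sq h (fst u) (fst (snd u)) (snd (snd u))" for u :: "real \<times> real \<times> real"
  have arm0: "arm R0 0 = R0" using R0(1) by (simp add: arm_def)
  have P_eq: "P R0 = g c * R0 ^ 3"
    unfolding P_def g_def momentum_sq_def c_def H_eq fst_conv snd_conv arm0
    using R0(1) pos by (simp add: field_simps eval_nat_numeral)
  have g_pos: "0 < g c"
  proof -
    have "0 < M * B / 2" using pos by simp
    then have "0 < g c * R0 ^ 3" unfolding P_eq[symmetric] using R0(2) by (rule less_trans)
    then show ?thesis using R0(1) by (simp add: zero_less_mult_iff)
  qed
  have g_cont: "isCont g c"
    unfolding g_def momentum_sq_def H_eq arm_def using R0(1) pos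
    by (intro continuous_intros) (auto simp: c_def)
  have arm_cont: "isCont (\<lambda>u. arm 1 (fst (snd u) / fst u)) c" "arm 1 (fst (snd c) / fst c) \<noteq> 0"
    unfolding arm_def using R0(1) by (auto intro!: continuous_intros simp: c_def)
  have e: "eventually (\<lambda>u. 0 < fst u) (nhds c)"
    "eventually (\<lambda>u. fst u < 1) (nhds c)"
    "eventually (\<lambda>u. 4 * C\<^sup>2 * fst u < 3 * B * M) (nhds c)"
    "eventually (\<lambda>u. \<bar>fst (snd u)\<bar> - s0 * fst u < 0) (nhds c)"
    "eventually (\<lambda>u. 0 < g u) (nhds c)"
    "eventually (\<lambda>u. M * B / 2 < g u * fst u ^ 3) (nhds c)"
    "eventually (\<lambda>u. shape_energy (fst u) (fst (snd u)) (- sqrt (g u)) (snd (snd u)) + drift s0 * fst u < shape_well s0) (nhds c)"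
  proof -
    show "eventually (\<lambda>u. 0 < fst u) (nhds c)"
      by (rule eventually_nhds_greater) (use R0 in \<open>auto simp: c_def intro!: continuous_intros\<close>)
    show "eventually (\<lambda>u. fst u < 1) (nhds c)"
      by (rule eventually_nhds_less) (use R0 in \<open>auto simp: c_def intro!: continuous_intros\<close>)
    show "eventually (\<lambda>u. 4 * C\<^sup>2 * fst u < 3 * B * M) (nhds c)"
      by (rule eventually_nhds_less) (use R0 in \<open>auto simp: c_def intro!: continuous_intros\<close>)
    show "eventually (\<lambda>u. \<bar>fst (snd u)\<bar> - s0 * fst u < 0) (nhds c)"
      by (rule eventually_nhds_less) (use R0 assms in \<open>auto simp: c_def intro!: continuous_intros\<close>)
    show "eventually (\<lambda>u. 0 < g u) (nhds c)"
      by (rule eventually_nhds_greater[OF g_cont g_pos])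
    show "eventually (\<lambda>u. M * B / 2 < g u * fst u ^ 3) (nhds c)"
    proof (rule eventually_nhds_greater)
      show "M * B / 2 < g c * fst c ^ 3" using R0(2) P_eq by (simp add: c_def)
    qed (intro continuous_intros g_cont)
    show "eventually (\<lambda>u. shape_energy (fst u) (fst (snd u)) (- sqrt (g u)) (snd (snd u)) + drift s0 * fst u < shape_well s0) (nhds c)"
    proof (rule eventually_nhds_less)
      show "shape_energy (fst c) (fst (snd c)) (- sqrt (g c)) (snd (snd c)) + drift s0 * fst c < shape_well s0"
        using R0 by (simp add: c_def shape_energy_def shape_momentum_def shape_well_def arm_def)
      show "isCont (\<lambda>u. shape_energy (fst u) (fst (snd u)) (- sqrt (g u)) (snd (snd u)) + drift s0 * fst u) c"
        unfolding shape_energy_def shape_momentum_def shape_well_def using R0(1) pos arm_cont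
        by (intro continuous_intros g_cont arm_cont(1)) (auto simp: c_def)
    qed
  qed
  have "eventually (\<lambda>u. lift h u \<in> trap s0 \<and> lift h u \<in> energy_level H h) (nhds c)"
    using e
  proof eventually_elim
    case (elim u)
    obtain R z q where u: "u = (R, z, q)" by (cases u)
    have "(- sqrt (g u))\<^sup>2 = g u" using elim(5) by simp
    with elim have "lift h u \<in> trap s0"
      by (simp add: u lift_def trap_def g_def)
    moreover have "lift h u \<in> energy_level H h"
      using elim(1,5) unfolding u by (intro lift_in_energy_level) (auto simp: g_def)
    ultimately show ?case by blast
  qed
  then obtain r where r: "0 < r"
    "\<And>u. dist u c < r \<Longrightarrow> lift h u \<in> trap s0 \<and> lift h u \<in> energy_level H h"
    unfolding eventually_nhds_metric by blast
  have "lift h u \<in> trap s0 \<and> lift h u \<in> energy_level H h" if "u \<in> ball c r" for u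
    using that by (intro r(2)) (simp only: mem_ball dist_commute)
  with r(1) show ?thesis by blast
qed

lemma borel_energy_level: "energy_level H h \<in> sets borel"
proof -
  have [measurable]: "(\<lambda>x::phase. fst x) \<in> borel_measurable borel"
    "(\<lambda>x::phase. fst (snd x)) \<in> borel_measurable borel"
    "(\<lambda>x::phase. fst (snd (snd x))) \<in> borel_measurable borel"
    "(\<lambda>x::phase. snd (snd (snd x))) \<in> borel_measurable borel"
    by (intro borel_measurable_continuous_onI continuous_intros)+
  have "energy_level H h = {x. 0 < fst x \<and> H (fst x) (fst (snd x)) (fst (snd (snd x))) (snd (snd (snd x))) = h}"
    by (auto simp: energy_level_def phase_space_def)
  also have "\<dots> \<in> sets borel"
    unfolding H_eq arm_def by measurable
  finally show ?thesis .
qed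

text \<open>
  The set contains a piece of the level that projects onto a ball, and it is measurable because both
  the level and the set of all collision points are Borel.
\<close>

theorem triple_collision_set_positive_measure:
  assumes "1 + B / (16 * B1) < \<mu>"
  shows "0 < emeasure (hypersurface_measure (energy_level H h))
    {x \<in> energy_level H h. leads_to_triple_collision H x}"
proof -
  let ?S = "{x \<in> energy_level H h. leads_to_triple_collision H x}"
  from ex_shape_well_barrier[OF assms] obtain s0 where s0: "0 < s0" "0 < shape_well s0"
    "\<And>s. \<bar>s\<bar> \<le> s0 \<Longrightarrow> 0 \<le> shape_well s" by blast
  from ex_ball_in_trap[OF s0(2,1), of h] obtain c r where r: "0 < r"
    "\<And>u. u \<in> ball c r \<Longrightarrow> lift h u \<in> trap s0 \<and> lift h u \<in> energy_level H h" by blast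
  define \<pi> :: "phase \<Rightarrow> real \<times> real \<times> real" where "\<pi> = (\<lambda>(R, z, p, q). (R, z, q))"
  have \<pi>_lift: "\<pi> (lift h u) = u" for u by (auto simp: \<pi>_def lift_def split: prod.split)
  have sub: "lift h ` ball c r \<subseteq> ?S"
    using r(2) trap_leads_to_triple_collision[OF s0] by blast
  have "0 < hausdorff_outer DIM(real \<times> real \<times> real) (lift h ` ball c r)"
  proof (rule hausdorff_outer_pos_of_projection[OF _ r(1)])
    show "dist (\<pi> x) (\<pi> y) \<le> dist x y" for x y
      by (cases x; cases y) (simp add: \<pi>_def dist_prod_def)
    show "ball c r \<subseteq> \<pi> ` lift h ` ball c r" by (force simp: image_image \<pi>_lift)
  qed
  also have "DIM(real \<times> real \<times> real) = 3" by simp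
  also have "hausdorff_outer 3 (lift h ` ball c r) \<le> hausdorff_outer 3 ?S"
    by (rule hausdorff_outer_mono[OF sub])
  also have "\<dots> = emeasure (hausdorff_measure 3) ?S"
  proof -
    have "?S = energy_level H h \<inter> {x. leads_to_triple_collision H x}" by auto
    also have "\<dots> \<in> sets borel"
      by (intro sets.Int borel_energy_level borel_leads_to_triple_collision)
    finally show ?thesis
      by (intro emeasure_hausdorff_measure[symmetric] borel_sets_hausdorff_measure)
  qed
  also have "\<dots> = emeasure (hypersurface_measure (energy_level H h)) ?S"
    unfolding hypersurface_measure_def
    by (rule emeasure_restrict_space[symmetric])
      (auto simp: space_hausdorff_measure intro: borel_sets_hausdorff_measure borel_energy_level)
  finally show ?thesis .
qed

end

theorem corollary1:
  fixes M m A A1 B B1 \<mu> C h :: real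
  assumes "M > 0" and "m > 0" and "A > 0" and "A1 > 0" and "B > 0" and "B1 > 0"
    and "\<mu> = (2 * M + m) / m"
    and "\<mu> > 1 + A / (4 * A1)"
    and "\<mu> > 1 + B / (16 * B1)"
    and "(\<mu> - 1) powr (4/15) * (4 * A1 / A) powr (2/3) \<noteq> (16 * B1 / B) powr (2/5)"
  shows "0 < emeasure (hypersurface_measure (energy_level (H_red M m A A1 B B1 C) h))
               {x \<in> energy_level (H_red M m A A1 B B1 C) h.
                  leads_to_triple_collision (H_red M m A A1 B B1 C) x}"
proof -
  interpret isosceles_schwarzschild M m A A1 B B1 C
    using assms(1-6) by unfold_locales
  show ?thesis
    using triple_collision_set_positive_measure[of h] assms(7,9)
    unfolding H_def isosceles_schwarzschild.\<mu>_def[OF isosceles_schwarzschild_axioms] by simp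
qed

end
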